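(* Let $Q=\{(X,X)=0\}\subset\mathbb P^{n+3}$ be the smooth $(n+2)$-dimensional quadric defined by the symmetric bilinear form on $\mathbb R^{n+4}$ $$(X,Y)=\varepsilon^1X_1Y_1+\dots+\varepsilon^nX_nY_n-X_0Y_{n+1}-X_{n+1}Y_0-X_{n+2}Y_{n+3}-X_{n+3}Y_{n+2},\qquad \varepsilon^i=\pm1,$$ and let $F_{1,n+2}$ be the $(2n+1)$-dimensional Fano variety of (real) projective lines lying on $Q$. Then the codimension one distribution $\tau$ on $F_{1,n+2}$ defines a contact structure on $F_{1,n+2}$.
   Context: Let $l\in F_{1,n+2}$ be the projectivization of a plane $\Lambda\subset\mathbb R^{n+4}$ (totally isotropic for $(\cdot,\cdot)$). The tangent space is $$T_lF_{1,n+2}=\{\overline\varphi\in\mathrm{Hom}(\Lambda,\mathbb R^{n+4}/\Lambda):\ \overline\varphi(v)\in T_{[v]}Q/\Lambda\ \text{ for all } v\in\Lambda\},$$ where $T_{[v]}Q$ denotes the linear subspace $\{w:(v,w)=0\}$. For a representative $\varphi\in\mathrm{Hom}(\Lambda,\mathbb R^{n+4})$ of $\overline\varphi$ and a basis $X,Y$ of $\Lambda$ this condition reads $$(X,\varphi(X))=(Y,\varphi(Y))=(X,\varphi(Y))+(Y,\varphi(X))=0.$$ The distribution $\tau$ of codimension one on $F_{1,n+2}$ is defined by the additional constraint $(X,\varphi(Y))=0$ (which depends neither on the basis $X,Y$ of $\Lambda$ nor on the representative $\varphi$). *)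

theory Defs
  imports "HOL-Analysis.Analysis"
begin

section \<open>Smooth maps and contact forms on open subsets of Euclidean space\<close>

(* Meaningful for open S. In finite dimension, continuity of all iterated directional
   derivatives is the usual C^k condition. *)
primrec Ck_on :: "nat \<Rightarrow> 'a::euclidean_space set \<Rightarrow> ('a \<Rightarrow> 'b::real_normed_vector) \<Rightarrow> bool" where
  "Ck_on 0 S f \<longleftrightarrow> continuous_on S f"
| "Ck_on (Suc k) S f \<longleftrightarrow> (\<forall>x\<in>S. f differentiable at x) \<and>
     (\<forall>v. Ck_on k S (\<lambda>x. frechet_derivative f (at x) v))"

definition smooth_on :: "'a::euclidean_space set \<Rightarrow> ('a \<Rightarrow> 'b::real_normed_vector) \<Rightarrow> bool" where
  "smooth_on S f \<longleftrightarrow> (\<forall>k. Ck_on k S f)"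

definition smooth_one_form_on :: "'a::euclidean_space set \<Rightarrow> ('a \<Rightarrow> 'a \<Rightarrow> real) \<Rightarrow> bool" where
  "smooth_one_form_on S \<alpha> \<longleftrightarrow> (\<forall>x\<in>S. linear (\<alpha> x)) \<and> (\<forall>h. smooth_on S (\<lambda>x. \<alpha> x h))"

definition ext_deriv :: "('a::euclidean_space \<Rightarrow> 'a \<Rightarrow> real) \<Rightarrow> 'a \<Rightarrow> 'a \<Rightarrow> 'a \<Rightarrow> real" where
  "ext_deriv \<alpha> x h k =
     frechet_derivative (\<lambda>y. \<alpha> y k) (at x) h - frechet_derivative (\<lambda>y. \<alpha> y h) (at x) k"

(* The value of the (2 n + 1)-form a /\ w /\ ... /\ w (n factors w), for a 1-form a and a 2-form w,
   on the vectors v 0, ..., v (2 n).  Convention: the wedge product of forms of degrees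
   k_1, ..., k_r is 1 / (k_1! ... k_r!) times the alternating sum over all permutations. *)
definition wedge_power ::
    "('a \<Rightarrow> real) \<Rightarrow> ('a \<Rightarrow> 'a \<Rightarrow> real) \<Rightarrow> nat \<Rightarrow> (nat \<Rightarrow> 'a) \<Rightarrow> real" where
  "wedge_power a w n v = (1 / 2 ^ n) *
     (\<Sum>\<sigma> | \<sigma> permutes {..<2 * n + 1}.
        of_int (sign \<sigma>) * a (v (\<sigma> 0)) * (\<Prod>i<n. w (v (\<sigma> (2 * i + 1))) (v (\<sigma> (2 * i + 2)))))"

definition contact_form_on :: "'a::euclidean_space set \<Rightarrow> ('a \<Rightarrow> 'a \<Rightarrow> real) \<Rightarrow> bool" where
  "contact_form_on S \<alpha> \<longleftrightarrow> smooth_one_form_on S \<alpha> \<and>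
     (\<exists>n. DIM('a) = 2 * n + 1 \<and> (\<forall>x\<in>S. \<exists>v. wedge_power (\<alpha> x) (ext_deriv \<alpha> x) n v \<noteq> 0))"

definition contact_distribution_on :: "'a::euclidean_space set \<Rightarrow> ('a \<Rightarrow> 'a set) \<Rightarrow> bool" where
  "contact_distribution_on U \<xi> \<longleftrightarrow>
     (\<forall>u\<in>U. \<exists>V \<alpha>. open V \<and> u \<in> V \<and> V \<subseteq> U \<and> contact_form_on V \<alpha> \<and>
        (\<forall>x\<in>V. \<xi> x = {h. \<alpha> x h = 0}))"


section \<open>The quadric and its lines\<close>

(* A vector of R^(n+4) has the coordinates X_1, ..., X_n at the indices Inl i, and
   X_0, X_(n+1), X_(n+2), X_(n+3) at the indices Inr 0, Inr 1, Inr 2, Inr 3. *)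
type_synonym 'n vec4 = "real ^ ('n + 4)"

definition form :: "('n::finite \<Rightarrow> real) \<Rightarrow> 'n vec4 \<Rightarrow> 'n vec4 \<Rightarrow> real" where
  "form \<epsilon> X Y = (\<Sum>i\<in>UNIV. \<epsilon> i * X $ Inl i * Y $ Inl i)
     - X $ Inr 0 * Y $ Inr 1 - X $ Inr 1 * Y $ Inr 0
     - X $ Inr 2 * Y $ Inr 3 - X $ Inr 3 * Y $ Inr 2"

(* The affine cone over the projective quadric Q. *)
definition quadric_cone :: "('n::finite \<Rightarrow> real) \<Rightarrow> 'n vec4 set" where
  "quadric_cone \<epsilon> = {v. form \<epsilon> v v = 0}"

definition tangent_quadric :: "('n::finite \<Rightarrow> real) \<Rightarrow> 'n vec4 \<Rightarrow> 'n vec4 set" where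
  "tangent_quadric \<epsilon> v = {w. form \<epsilon> v w = 0}"

(* A projective line l is identified with the plane L of which it is the projectivization. *)
definition fano :: "('n::finite \<Rightarrow> real) \<Rightarrow> 'n vec4 set set" where
  "fano \<epsilon> = {L. subspace L \<and> dim L = 2 \<and> L \<subseteq> quadric_cone \<epsilon>}"

definition fano_frames :: "('n::finite \<Rightarrow> real) \<Rightarrow> ('n vec4 \<times> 'n vec4) set" where
  "fano_frames \<epsilon> = {(X, Y). span {X, Y} \<in> fano \<epsilon>}"

(* The quotient topology under the map (X, Y) |-> span {X, Y}, which is the topology induced
   from the Grassmannian of planes. *)
definition fano_topology :: "('n::finite \<Rightarrow> real) \<Rightarrow> 'n vec4 set topology" where
  "fano_topology \<epsilon> = topology (\<lambda>S. S \<subseteq> fano \<epsilon> \<and>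
     openin (top_of_set (fano_frames \<epsilon>)) {(X, Y) \<in> fano_frames \<epsilon>. span {X, Y} \<in> S})"

lemma openin_fano_topology:
  "openin (fano_topology \<epsilon>) S \<longleftrightarrow> S \<subseteq> fano \<epsilon> \<and>
     openin (top_of_set (fano_frames \<epsilon>)) {(X, Y) \<in> fano_frames \<epsilon>. span {X, Y} \<in> S}"
proof -
  let ?P = "\<lambda>S. {(X, Y) \<in> fano_frames \<epsilon>. span {X, Y} \<in> S}"
  have int: "?P (S \<inter> T) = ?P S \<inter> ?P T" for S T by auto
  have un: "?P (\<Union>K) = \<Union>(?P ` K)" for K by auto
  have "istopology (\<lambda>S. S \<subseteq> fano \<epsilon> \<and> openin (top_of_set (fano_frames \<epsilon>)) (?P S))"
    unfolding istopology_def int un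
    by (intro conjI allI impI openin_Int openin_Union) auto
  then show ?thesis
    by (simp add: fano_topology_def topology_inverse')
qed


section \<open>Tangent spaces, charts and the distribution\<close>

(* The homomorphism L -> R^(n+4) / L represented by \<phi>; elements of the quotient are the cosets of L. *)
definition quot_hom :: "'v::real_vector set \<Rightarrow> ('v \<Rightarrow> 'v) \<Rightarrow> 'v \<Rightarrow> 'v set" where
  "quot_hom L \<phi> = (\<lambda>v\<in>L. (+) (\<phi> v) ` L)"

definition Hom_quot :: "'v::real_vector set \<Rightarrow> ('v \<Rightarrow> 'v set) set" where
  "Hom_quot L = {quot_hom L \<phi> |\<phi>. linear \<phi>}"

definition tangent_fano :: "('n::finite \<Rightarrow> real) \<Rightarrow> 'n vec4 set \<Rightarrow> ('n vec4 \<Rightarrow> 'n vec4 set) set" where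
  "tangent_fano \<epsilon> L =
     {\<Phi> \<in> Hom_quot L. \<forall>v\<in>L. \<Phi> v \<in> (\<lambda>w. (+) w ` L) ` tangent_quadric \<epsilon> v}"

definition tau :: "('n::finite \<Rightarrow> real) \<Rightarrow> 'n vec4 set \<Rightarrow> ('n vec4 \<Rightarrow> 'n vec4 set) set" where
  "tau \<epsilon> L = {\<Phi> \<in> tangent_fano \<epsilon> L.
     \<forall>\<phi> X Y. linear \<phi> \<and> \<Phi> = quot_hom L \<phi> \<and> span {X, Y} = L \<longrightarrow> form \<epsilon> X (\<phi> Y) = 0}"

(* Smoothness of a map into the Grassmannian of planes. *)
definition smooth_plane_map :: "'e::euclidean_space set \<Rightarrow> ('e \<Rightarrow> 'v::euclidean_space set) \<Rightarrow> bool" where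
  "smooth_plane_map U \<psi> \<longleftrightarrow>
     (\<forall>u\<in>U. \<exists>V X Y. open V \<and> u \<in> V \<and> V \<subseteq> U \<and> smooth_on V X \<and> smooth_on V Y \<and>
        (\<forall>x\<in>V. \<psi> x = span {X x, Y x} \<and> dim (\<psi> x) = 2))"

(* The differential at u of a smooth map \<psi> into the Grassmannian, with values in
   Hom (\<psi> u, R^(n+4) / \<psi> u): a vector v of the plane \<psi> u is sent to the class of the derivative
   at u, in direction h, of any smooth local section s of \<psi> (that is, s x \<in> \<psi> x) with s u = v. *)
definition plane_differential ::
    "('e::euclidean_space \<Rightarrow> 'v::euclidean_space set) \<Rightarrow> 'e \<Rightarrow> 'e \<Rightarrow> 'v \<Rightarrow> 'v set" where
  "plane_differential \<psi> u h = (\<lambda>v\<in>\<psi> u.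
     {frechet_derivative s (at u) h + w | s V w.
        open V \<and> u \<in> V \<and> smooth_on V s \<and> (\<forall>x\<in>V. s x \<in> \<psi> x) \<and> s u = v \<and> w \<in> \<psi> u})"

(* A local parametrization (inverse chart) of F defined on an open subset of R^(2n+1). *)
definition fano_chart ::
    "('n::finite \<Rightarrow> real) \<Rightarrow> (real ^ ('n + 'n + 1)) set \<Rightarrow> (real ^ ('n + 'n + 1) \<Rightarrow> 'n vec4 set) \<Rightarrow> bool"
  where
  "fano_chart \<epsilon> U \<psi> \<longleftrightarrow>
     open U \<and> \<psi> ` U \<subseteq> fano \<epsilon> \<and> inj_on \<psi> U \<and> smooth_plane_map U \<psi> \<and>
     open_map (top_of_set U) (fano_topology \<epsilon>) \<psi> \<and>
     (\<forall>u\<in>U. bij_betw (plane_differential \<psi> u) UNIV (tangent_fano \<epsilon> (\<psi> u)))"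

(* D assigns to a plane L in F a set of tangent vectors at L. F is covered by the domains of charts,
   and D is a contact distribution in the coordinates of every chart. *)
definition contact_structure_on_fano ::
    "('n::finite \<Rightarrow> real) \<Rightarrow> ('n vec4 set \<Rightarrow> ('n vec4 \<Rightarrow> 'n vec4 set) set) \<Rightarrow> bool" where
  "contact_structure_on_fano \<epsilon> D \<longleftrightarrow>
     (\<forall>L\<in>fano \<epsilon>. D L \<subseteq> tangent_fano \<epsilon> L) \<and>
     (\<forall>L\<in>fano \<epsilon>. \<exists>U \<psi>. fano_chart \<epsilon> U \<psi> \<and> L \<in> \<psi> ` U) \<and>
     (\<forall>U \<psi>. fano_chart \<epsilon> U \<psi> \<longrightarrow>
        contact_distribution_on U (\<lambda>u. {h. plane_differential \<psi> u h \<in> D (\<psi> u)}))"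

end

theory Submission imports Defs begin

text \<open>Write \<open>form u v = u \<bullet> J v\<close> with the Euclidean inner product and the symmetric involution
  \<open>J\<close> (called \<open>polarity\<close>). An isotropic plane \<open>L\<close> with orthonormal basis \<open>X0\<close>, \<open>Y0\<close> is in
  hyperbolic duality with \<open>J L\<close>, and the orthogonal complement \<open>E\<close> of \<open>L + J L\<close> is a
  \<open>J\<close>-invariant space of dimension \<open>n\<close>. The isotropic planes that project isomorphically to \<open>L\<close>
  are graphs, parametrized polynomially by \<open>E \<times> E \<times> R\<close>; this gives the charts.

  In any chart with local frame \<open>X\<close>, \<open>Y\<close> the distribution is the kernel of
  \<open>\<alpha> = form X (dY)\<close>, and \<open>d\<alpha> (h, k) = form (dX h) (dY k) - form (dX k) (dY h)\<close>. On \<open>ker \<alpha>\<close>,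
  which modulo \<open>L\<close> is \<open>E \<times> E\<close>, this is the standard symplectic form
  \<open>form e f' - form e' f\<close>, with symplectic basis \<open>(e_i, 0)\<close>, \<open>(0, J e_i)\<close> for an orthonormal
  basis \<open>e_i\<close> of \<open>E\<close>.\<close>

section \<open>Calculus of smooth maps\<close>

lemma Ck_on_imp_continuous_on: "Ck_on k S f \<Longrightarrow> continuous_on S f"
  by (cases k) (auto intro!: continuous_at_imp_continuous_on differentiable_imp_continuous_within)

text \<open>In the inductions below this replaces a derivative on \<open>S\<close> by its explicit
  formula; openness of \<open>S\<close> lets equality of the functions pass to their
  derivatives.\<close>

lemma Ck_on_cong:
  assumes "open S" "\<And>x. x \<in> S \<Longrightarrow> f x = g x" "Ck_on k S f"
  shows "Ck_on k S g"
  using assms(2,3)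
proof (induction k arbitrary: f g)
  case 0
  then show ?case by (simp cong: continuous_on_cong)
next
  case (Suc k)
  have diff: "g differentiable at x" if "x \<in> S" for x
    using Suc.prems that assms(1)
    by (metis Ck_on.simps(2) differentiable_def has_derivative_transform_within_open)
  have "frechet_derivative f (at x) = frechet_derivative g (at x)" if "x \<in> S" for x
    using Suc.prems that assms(1) by (auto intro!: frechet_derivative_transform_within_open)
  then have "Ck_on k S (\<lambda>x. frechet_derivative g (at x) v)" for v
    using Suc.IH[of "\<lambda>x. frechet_derivative f (at x) v"] Suc.prems by auto
  with diff show ?case by simp
qed

lemma Ck_on_SucD: "Ck_on (Suc k) S f \<Longrightarrow> Ck_on k S f"
proof (induction k arbitrary: f)
  case 0
  then show ?case using Ck_on_imp_continuous_on[OF 0] by simp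
next
  case (Suc k)
  show ?case
    unfolding Ck_on.simps(2)
    using Suc.IH Suc.prems unfolding Ck_on.simps(2)[of "Suc k"] by blast
qed

lemma Ck_on_const: "Ck_on k S (\<lambda>x. c)"
  by (induction k arbitrary: c) auto

lemma Ck_on_bounded_linear:
  assumes "bounded_linear f"
  shows "Ck_on k S f"
proof (cases k)
  case 0
  then show ?thesis using assms by (simp add: linear_continuous_on)
next
  case (Suc k)
  have "(f has_derivative f) (at x)" for x
    using assms by (rule bounded_linear_imp_has_derivative)
  then have "f differentiable at x" "frechet_derivative f (at x) = f" for x
    by (auto simp: differentiable_def frechet_derivative_at[symmetric])
  then show ?thesis using Suc by (simp add: Ck_on_const)
qed

lemma Ck_on_add:
  assumes "open S" "Ck_on k S f" "Ck_on k S g"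
  shows "Ck_on k S (\<lambda>x. f x + g x)"
  using assms(2,3)
proof (induction k arbitrary: f g)
  case 0
  then show ?case by (simp add: continuous_on_add)
next
  case (Suc k)
  let ?D = "\<lambda>x v. frechet_derivative f (at x) v + frechet_derivative g (at x) v"
  have der: "((\<lambda>x. f x + g x) has_derivative ?D x) (at x)" if "x \<in> S" for x
    using Suc.prems that by (auto intro!: has_derivative_add simp: frechet_derivative_works)
  have "Ck_on k S (\<lambda>x. ?D x v)" for v
    using Suc by simp
  then have "Ck_on k S (\<lambda>x. frechet_derivative (\<lambda>x. f x + g x) (at x) v)" for v
    by (rule Ck_on_cong[OF assms(1), rotated]) (simp add: frechet_derivative_at[OF der, symmetric])
  with der show ?case by (auto simp: differentiable_def)
qed

text \<open>Product rule: each term of the derivative is again \<open>B\<close> of two functions,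
  one of them undifferentiated. The induction hypothesis applies once \<open>Ck_on_SucD\<close>
  lowers the order of that factor.\<close>

lemma Ck_on_bilinear:
  assumes "bounded_bilinear B" "open S" "Ck_on k S f" "Ck_on k S g"
  shows "Ck_on k S (\<lambda>x. B (f x) (g x))"
  using assms(3,4)
proof (induction k arbitrary: f g)
  case 0
  then show ?case by (simp add: bounded_bilinear.continuous_on[OF assms(1)])
next
  case (Suc k)
  let ?D = "\<lambda>x v. B (f x) (frechet_derivative g (at x) v) + B (frechet_derivative f (at x) v) (g x)"
  have der: "((\<lambda>x. B (f x) (g x)) has_derivative ?D x) (at x)" if "x \<in> S" for x
    using Suc.prems that
    by (auto intro!: bounded_bilinear.FDERIV[OF assms(1)] simp: frechet_derivative_works)
  have "Ck_on k S f" "Ck_on k S g"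
    using Suc.prems by (auto intro: Ck_on_SucD)
  then have "Ck_on k S (\<lambda>x. ?D x v)" for v
    using Suc assms(2) by (auto intro!: Ck_on_add)
  then have "Ck_on k S (\<lambda>x. frechet_derivative (\<lambda>x. B (f x) (g x)) (at x) v)" for v
    by (rule Ck_on_cong[OF assms(2), rotated]) (simp add: frechet_derivative_at[OF der, symmetric])
  with der show ?case by (auto simp: differentiable_def)
qed

lemma smooth_on_const: "smooth_on S (\<lambda>x. c)"
  by (simp add: smooth_on_def Ck_on_const)

lemma smooth_on_bounded_linear: "bounded_linear f \<Longrightarrow> smooth_on S f"
  by (simp add: smooth_on_def Ck_on_bounded_linear)

lemma smooth_on_add:
  "open S \<Longrightarrow> smooth_on S f \<Longrightarrow> smooth_on S g \<Longrightarrow> smooth_on S (\<lambda>x. f x + g x)"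
  by (simp add: smooth_on_def Ck_on_add)

lemma smooth_on_bilinear:
  "bounded_bilinear B \<Longrightarrow> open S \<Longrightarrow> smooth_on S f \<Longrightarrow> smooth_on S g \<Longrightarrow>
     smooth_on S (\<lambda>x. B (f x) (g x))"
  by (simp add: smooth_on_def Ck_on_bilinear)

lemma smooth_on_frechet_derivative:
  "smooth_on S f \<Longrightarrow> smooth_on S (\<lambda>x. frechet_derivative f (at x) v)"
  unfolding smooth_on_def using Ck_on.simps(2) by blast

lemma smooth_on_has_derivative:
  assumes "smooth_on S f" "x \<in> S"
  shows "(f has_derivative frechet_derivative f (at x)) (at x)"
  using assms Ck_on.simps(2)[of 0 S f] by (auto simp: smooth_on_def frechet_derivative_works)

section \<open>Symmetry of second derivatives\<close>

lemma second_difference_mean_value: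
  fixes f :: "'a::euclidean_space \<Rightarrow> real"
  assumes S: "open S" "smooth_on S f" and "0 < t"
    and sub: "\<And>r s. 0 \<le> r \<Longrightarrow> r \<le> t \<Longrightarrow> 0 \<le> s \<Longrightarrow> s \<le> t \<Longrightarrow> x + r *\<^sub>R h + s *\<^sub>R k \<in> S"
  obtains r s where "0 < r" "r < t" "0 < s" "s < t"
    "f (x + t *\<^sub>R h + t *\<^sub>R k) - f (x + t *\<^sub>R h) - f (x + t *\<^sub>R k) + f x =
     t * (t * frechet_derivative (\<lambda>y. frechet_derivative f (at y) h) (at (x + r *\<^sub>R h + s *\<^sub>R k)) k)"
proof -
  let ?Df = "\<lambda>y. frechet_derivative f (at y)"
  \<comment> \<open>\<open>\<phi>\<close> is the difference of \<open>f\<close> in direction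
    \<open>k\<close>, so its increment from 0 to \<open>t\<close> is the second difference.\<close>
  define \<phi> where "\<phi> r = f (x + r *\<^sub>R h + t *\<^sub>R k) - f (x + r *\<^sub>R h)" for r
  have line: "((\<lambda>r. f (x + r *\<^sub>R h + s *\<^sub>R k)) has_real_derivative
      ?Df (x + r *\<^sub>R h + s *\<^sub>R k) h) (at r)"
    if "0 \<le> r" "r \<le> t" "0 \<le> s" "s \<le> t" for r s
  proof -
    have "((\<lambda>r. f (x + r *\<^sub>R h + s *\<^sub>R k)) has_derivative
        (\<lambda>d. ?Df (x + r *\<^sub>R h + s *\<^sub>R k) (d *\<^sub>R h))) (at r)"
      by (rule has_derivative_compose[where f = "\<lambda>r. x + r *\<^sub>R h + s *\<^sub>R k" and g = f,
            OF _ smooth_on_has_derivative[OF S(2) sub[OF that]]])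
         (auto intro!: derivative_eq_intros)
    moreover have "linear (?Df (x + r *\<^sub>R h + s *\<^sub>R k))"
      using smooth_on_has_derivative[OF S(2) sub[OF that]] by (rule has_derivative_linear)
    ultimately show ?thesis
      by (simp add: has_field_derivative_def linear_cmul mult_commute_abs)
  qed
  \<comment> \<open>The mean value theorem in direction \<open>h\<close>; a second application, in
    direction \<open>k\<close>, turns the remaining difference of first derivatives into a second
    derivative.\<close>
  have "\<exists>r>0. r < t \<and> \<phi> t - \<phi> 0 = (t - 0) * (?Df (x + r *\<^sub>R h + t *\<^sub>R k) h - ?Df (x + r *\<^sub>R h) h)"
  proof (rule MVT2[OF \<open>0 < t\<close>])
    fix r assume r: "0 \<le> r" "r \<le> t"
    show "DERIV \<phi> r :> ?Df (x + r *\<^sub>R h + t *\<^sub>R k) h - ?Df (x + r *\<^sub>R h) h"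
      unfolding \<phi>_def
      using DERIV_diff[OF line[OF r, of t] line[OF r, of 0]] \<open>0 < t\<close> by simp
  qed
  then obtain r where r: "0 < r" "r < t"
    and r': "\<phi> t - \<phi> 0 = t * (?Df (x + r *\<^sub>R h + t *\<^sub>R k) h - ?Df (x + r *\<^sub>R h) h)" by auto
  let ?D2 = "\<lambda>y. frechet_derivative (\<lambda>y. ?Df y h) (at y)"
  have "\<exists>s>0. s < t \<and> ?Df (x + r *\<^sub>R h + t *\<^sub>R k) h - ?Df (x + r *\<^sub>R h + 0 *\<^sub>R k) h =
      (t - 0) * ?D2 (x + r *\<^sub>R h + s *\<^sub>R k) k"
  proof (rule MVT2[OF \<open>0 < t\<close>])
    fix s assume s: "0 \<le> s" "s \<le> t"
    have mem: "x + r *\<^sub>R h + s *\<^sub>R k \<in> S" using sub r s by simp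
    note D = smooth_on_has_derivative[OF smooth_on_frechet_derivative[OF S(2), of h] mem]
    have "((\<lambda>s. ?Df (x + r *\<^sub>R h + s *\<^sub>R k) h) has_derivative
        (\<lambda>d. ?D2 (x + r *\<^sub>R h + s *\<^sub>R k) (d *\<^sub>R k))) (at s)"
      by (rule has_derivative_compose[where f = "\<lambda>s. x + r *\<^sub>R h + s *\<^sub>R k" and
            g = "\<lambda>y. ?Df y h", OF _ D]) (auto intro!: derivative_eq_intros)
    then show "((\<lambda>s. ?Df (x + r *\<^sub>R h + s *\<^sub>R k) h) has_real_derivative
        ?D2 (x + r *\<^sub>R h + s *\<^sub>R k) k) (at s)"
      using has_derivative_linear[OF D]
      by (simp add: has_field_derivative_def linear_cmul mult_commute_abs)
  qed
  then obtain s where s: "0 < s" "s < t"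
    and "?Df (x + r *\<^sub>R h + t *\<^sub>R k) h - ?Df (x + r *\<^sub>R h) h = t * ?D2 (x + r *\<^sub>R h + s *\<^sub>R k) k"
    by auto
  with r' show ?thesis by (intro that[OF r s]) (simp add: \<phi>_def)
qed

text \<open>If the mixed derivatives differed at \<open>x\<close>, continuity would keep each within
  half the gap of its value there. But the second difference is symmetric in \<open>h\<close> and
  \<open>k\<close>, so they take a common value at points near \<open>x\<close>.\<close>

lemma second_derivative_symmetric_real:
  fixes f :: "'a::euclidean_space \<Rightarrow> real"
  assumes S: "open S" "smooth_on S f" and x: "x \<in> S"
  shows "frechet_derivative (\<lambda>y. frechet_derivative f (at y) h) (at x) k =
         frechet_derivative (\<lambda>y. frechet_derivative f (at y) k) (at x) h"
proof (rule ccontr)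
  let ?D = "\<lambda>h k y. frechet_derivative (\<lambda>y. frechet_derivative f (at y) h) (at y) k"
  let ?e = "\<bar>?D h k x - ?D k h x\<bar> / 2"
  assume "\<not> ?thesis"
  then have e: "?e > 0" by simp
  have "\<exists>d>0. \<forall>y. dist y x < d \<longrightarrow> dist (?D a b y) (?D a b x) < ?e" for a b
  proof -
    have "continuous_on S (?D a b)"
      using S(2) by (metis Ck_on_imp_continuous_on smooth_on_def smooth_on_frechet_derivative)
    then have "isCont (?D a b) x" using S(1) x by (simp add: continuous_on_eq_continuous_at)
    then show ?thesis using e unfolding continuous_at_eps_delta by blast
  qed
  then obtain d where d: "\<And>a b. d a b > 0"
    and dd: "\<And>a b y. dist y x < d a b \<Longrightarrow> dist (?D a b y) (?D a b x) < ?e" by metis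
  obtain c where c: "c > 0" "ball x c \<subseteq> S" using S(1) x openE by blast
  define m where "m = min c (min (d h k) (d k h))"
  have m: "m > 0" using c d by (simp add: m_def)
  \<comment> \<open>The parallelogram with sides \<open>t *\<^sub>R h\<close> and
    \<open>t *\<^sub>R k\<close> stays at distance less than \<open>m\<close> from \<open>x\<close>;
    the summand 1 keeps the denominator positive when \<open>h = k = 0\<close>.\<close>
  define t where "t = m / (norm h + norm k + 1)"
  have pos: "norm h + norm k + 1 > 0" by (simp add: add_nonneg_pos)
  have t: "0 < t" using m pos by (simp add: t_def)
  have near: "dist (x + r *\<^sub>R h + s *\<^sub>R k) x < m" if "0 \<le> r" "r \<le> t" "0 \<le> s" "s \<le> t" for r s
  proof -
    have "dist (x + r *\<^sub>R h + s *\<^sub>R k) x = norm (r *\<^sub>R h + s *\<^sub>R k)"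
      by (simp add: dist_norm add.assoc)
    also have "\<dots> \<le> r * norm h + s * norm k" using that norm_triangle_ineq[of "r *\<^sub>R h" "s *\<^sub>R k"] by simp
    also have "\<dots> \<le> t * norm h + t * norm k" using that by (intro add_mono mult_right_mono) auto
    also have "\<dots> < t * (norm h + norm k + 1)" using t by (simp add: algebra_simps)
    finally show ?thesis using pos by (simp add: t_def)
  qed
  then have sub: "x + r *\<^sub>R h + s *\<^sub>R k \<in> S" if "0 \<le> r" "r \<le> t" "0 \<le> s" "s \<le> t" for r s
    using c(2) that by (fastforce simp: m_def dist_commute)
  have sub': "x + r *\<^sub>R k + s *\<^sub>R h \<in> S" if "0 \<le> r" "r \<le> t" "0 \<le> s" "s \<le> t" for r s
    using sub[OF that(3,4,1,2)] by (simp add: ac_simps)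
  obtain r s where rs: "0 < r" "r < t" "0 < s" "s < t"
    and 1: "f (x + t *\<^sub>R h + t *\<^sub>R k) - f (x + t *\<^sub>R h) - f (x + t *\<^sub>R k) + f x =
      t * (t * ?D h k (x + r *\<^sub>R h + s *\<^sub>R k))"
    by (rule second_difference_mean_value[OF S t sub])
  obtain r' s' where rs': "0 < r'" "r' < t" "0 < s'" "s' < t"
    and 2: "f (x + t *\<^sub>R k + t *\<^sub>R h) - f (x + t *\<^sub>R k) - f (x + t *\<^sub>R h) + f x =
      t * (t * ?D k h (x + r' *\<^sub>R k + s' *\<^sub>R h))"
    by (rule second_difference_mean_value[OF S t sub'])
  have "t * (t * ?D h k (x + r *\<^sub>R h + s *\<^sub>R k)) = t * (t * ?D k h (x + r' *\<^sub>R k + s' *\<^sub>R h))"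
    unfolding 1[symmetric] 2[symmetric] by (simp add: ac_simps)
  then have eq: "?D h k (x + r *\<^sub>R h + s *\<^sub>R k) = ?D k h (x + s' *\<^sub>R h + r' *\<^sub>R k)"
    using t by (simp add: ac_simps)
  have "dist (?D h k (x + r *\<^sub>R h + s *\<^sub>R k)) (?D h k x) < ?e"
    using near[of r s] rs by (intro dd) (simp add: m_def)
  moreover have "dist (?D k h (x + s' *\<^sub>R h + r' *\<^sub>R k)) (?D k h x) < ?e"
    using near[of s' r'] rs' by (intro dd) (simp add: m_def)
  ultimately show False unfolding eq dist_real_def by argo
qed

lemma second_derivative_symmetric:
  fixes f :: "'a::euclidean_space \<Rightarrow> 'b::euclidean_space"
  assumes S: "open S" "smooth_on S f" and x: "x \<in> S"
  shows "frechet_derivative (\<lambda>y. frechet_derivative f (at y) h) (at x) k =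
         frechet_derivative (\<lambda>y. frechet_derivative f (at y) k) (at x) h"
proof (rule euclidean_eqI)
  fix b :: 'b
  have D: "frechet_derivative (\<lambda>y. g y \<bullet> b) (at y) v = frechet_derivative g (at y) v \<bullet> b"
    if "smooth_on S g" "y \<in> S" for g :: "'a \<Rightarrow> 'b" and y v
    using frechet_derivative_at[OF has_derivative_inner_left[OF smooth_on_has_derivative[OF that]]]
    by metis
  have "frechet_derivative (\<lambda>y. frechet_derivative (\<lambda>y. f y \<bullet> b) (at y) v) (at x) w =
      frechet_derivative (\<lambda>y. frechet_derivative f (at y) v) (at x) w \<bullet> b" for v w
  proof -
    have sm: "smooth_on S (\<lambda>y. frechet_derivative f (at y) v)"
      by (rule smooth_on_frechet_derivative[OF S(2)])
    have "frechet_derivative (\<lambda>y. frechet_derivative f (at y) v \<bullet> b) (at x) =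
        frechet_derivative (\<lambda>y. frechet_derivative (\<lambda>y. f y \<bullet> b) (at y) v) (at x)"
      by (rule frechet_derivative_transform_within_open[OF _ S(1) x])
         (use has_derivative_inner_left[OF smooth_on_has_derivative[OF sm x], of b] D[OF S(2)]
          in \<open>auto simp: differentiable_def\<close>)
    then show ?thesis using D[OF sm x, of w] by simp
  qed
  moreover have "smooth_on S (\<lambda>y. f y \<bullet> b)"
    by (rule smooth_on_bilinear[OF bounded_bilinear_inner S smooth_on_const])
  ultimately show "frechet_derivative (\<lambda>y. frechet_derivative f (at y) h) (at x) k \<bullet> b =
      frechet_derivative (\<lambda>y. frechet_derivative f (at y) k) (at x) h \<bullet> b"
    using second_derivative_symmetric_real[OF S(1) _ x, of "\<lambda>y. f y \<bullet> b" h k] by simp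
qed

section \<open>Volume of a symplectic basis\<close>

lemma pos_nat_parity: "k \<noteq> 0 \<Longrightarrow> \<exists>j. k = 2*j+1 \<or> k = 2*j+2" for k :: nat
  by presburger

lemma fixes_upto_Suc:
  fixes f :: "nat \<Rightarrow> nat"
  assumes "\<forall>k\<le>2*m. f k = k" "f (2*m+1) = 2*m+1" "f (2*m+2) = 2*m+2"
  shows "\<forall>k\<le>2 * Suc m. f k = k"
  using assms by (auto simp: le_Suc_eq)

abbreviation swap :: "nat \<Rightarrow> nat \<Rightarrow> nat \<Rightarrow> nat" where
  "swap \<equiv> Transposition.transpose"

lemma sign_comp_swap:
  assumes "\<sigma> permutes S" "finite S" "a \<in> S" "b \<in> S" "a \<noteq> b"
  shows "sign (\<sigma> \<circ> swap a b) = - sign \<sigma>"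
  using assms
  by (subst sign_compose) (auto intro: permutes_imp_permutation permutation_swap_id simp: sign_swap_id)

text \<open>On a symplectic basis every term of the alternating sum is nonnegative: a nonzero term comes
  from a permutation that permutes the pairs and swaps entries inside some of them, and the sign
  of the swaps is compensated by the antisymmetry of the 2-form.\<close>

lemma symplectic_summand:
  fixes W :: "nat \<Rightarrow> nat \<Rightarrow> real"
  assumes anti: "\<And>i j. W i j = - W j i"
    and eo: "\<And>i j. i < n \<Longrightarrow> j < n \<Longrightarrow> W (2*i+1) (2*j+2) = (if i = j then 1 else 0)"
    and oo: "\<And>i j. i < n \<Longrightarrow> j < n \<Longrightarrow> W (2*i+1) (2*j+1) = 0"
    and ee: "\<And>i j. i < n \<Longrightarrow> j < n \<Longrightarrow> W (2*i+2) (2*j+2) = 0"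
    and "\<sigma> permutes {..<2*n+1}"
    and "m \<le> n" "\<forall>k\<le>2*m. \<sigma> k = k"
    and "(\<Prod>i<n. W (\<sigma> (2*i+1)) (\<sigma> (2*i+2))) \<noteq> 0"
  shows "of_int (sign \<sigma>) * (\<Prod>i<n. W (\<sigma> (2*i+1)) (\<sigma> (2*i+2))) = 1"
  using assms(6,5,7,8)
\<comment> \<open>Downward induction on the number \<open>m\<close> of leading pairs
  \<open>2*i+1\<close>, \<open>2*i+2\<close> that \<open>\<sigma>\<close> fixes together with 0. At
  \<open>m = n\<close> only the identity remains, with all factors 1.\<close>
proof (induction m arbitrary: \<sigma> rule: inc_induct)
  case base
  then have "\<sigma> k = k" for k
    using permutes_not_in[OF base(1), of k] by (cases "k \<le> 2*n") auto
  then have id: "\<sigma> = id" by auto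
  have prod: "(\<Prod>i<n. W (2*i+1) (2*i+2)) = 1"
    by (intro prod.neutral ballI) (subst eo, auto)
  show ?case unfolding id sign_id by (simp only: id_apply of_int_1 mult_1 prod)
next
  case (step m)
  let ?S = "{..<2*n+1}"
  let ?P = "\<lambda>\<sigma>. \<Prod>i<n. W (\<sigma> (2*i+1)) (\<sigma> (2*i+2))"
  \<comment> \<open>The case where \<open>2*m+1\<close> is the value at the first place of pair
    \<open>i\<close>. The nonzero factor forces \<open>2*m+2\<close> at the second place, and
    exchanging the pairs \<open>i\<close> and \<open>m\<close> as wholes leads to the induction
    hypothesis.\<close>
  have main: "of_int (sign \<sigma>) * ?P \<sigma> = 1"
    if perm: "\<sigma> permutes ?S" and fix': "\<forall>k\<le>2*m. \<sigma> k = k" and nz: "?P \<sigma> \<noteq> 0"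
      and i: "m \<le> i" "i < n" and \<sigma>i: "\<sigma> (2*i+1) = 2*m+1" for \<sigma> i
  proof -
    note inj = permutes_inj[OF perm]
    have "W (\<sigma> (2*i+1)) (\<sigma> (2*i+2)) \<noteq> 0"
      using nz i(2) by (simp only: prod_zero_iff finite_lessThan) auto
    then have "W (2*m+1) (\<sigma> (2*i+2)) \<noteq> 0" by (simp only: \<sigma>i not_False_eq_True)
    moreover have "\<sigma> (2*i+2) \<in> ?S" using permutes_in_image[OF perm] i by simp
    moreover have "\<sigma> (2*i+2) \<noteq> 0" using fix' inj by (metis add_is_0 injD le0 zero_neq_numeral)
    ultimately have \<sigma>i2: "\<sigma> (2*i+2) = 2*m+2"
    proof -
      assume a: "W (2*m+1) (\<sigma> (2*i+2)) \<noteq> 0" "\<sigma> (2*i+2) \<in> ?S" "\<sigma> (2*i+2) \<noteq> 0"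
      obtain j where "\<sigma> (2*i+2) = 2*j+1 \<or> \<sigma> (2*i+2) = 2*j+2"
        using pos_nat_parity[OF a(3)] by blast
      with a step(2) eo[of m j] oo[of m j] show ?thesis by (auto split: if_splits)
    qed
    show ?thesis
    proof (cases "i = m")
      case True
      have "\<forall>k\<le>2 * Suc m. \<sigma> k = k"
        using fix' \<sigma>i \<sigma>i2 True by (intro fixes_upto_Suc) simp_all
      then show ?thesis by (rule step(3)[OF perm _ nz])
    next
      case False
      \<comment> \<open>Two disjoint transpositions: the sign is unchanged, and the product is only
        reindexed by \<open>swap m i\<close>.\<close>
      define \<rho> where "\<rho> = swap (2*m+1) (2*i+1) \<circ> swap (2*m+2) (2*i+2)"
      define \<sigma>' where "\<sigma>' = \<sigma> \<circ> \<rho>"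
      have \<sigma>': "\<sigma>' = \<sigma> \<circ> swap (2*m+1) (2*i+1) \<circ> swap (2*m+2) (2*i+2)"
        by (simp add: \<sigma>'_def \<rho>_def o_assoc)
      have p1: "\<sigma> \<circ> swap (2*m+1) (2*i+1) permutes ?S"
        using i step(2) by (intro permutes_compose[OF permutes_swap_id perm]) auto
      have p2: "\<sigma>' permutes ?S"
        unfolding \<sigma>' using i step(2) by (intro permutes_compose[OF permutes_swap_id p1]) auto
      have sgn: "sign \<sigma>' = sign \<sigma>"
      proof -
        have "sign \<sigma>' = - sign (\<sigma> \<circ> swap (2*m+1) (2*i+1))"
          unfolding \<sigma>' by (rule sign_comp_swap[OF p1]) (use i step(2) False in auto)
        also have "sign (\<sigma> \<circ> swap (2*m+1) (2*i+1)) = - sign \<sigma>"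
          by (rule sign_comp_swap[OF perm]) (use i step(2) False in auto)
        finally show ?thesis by simp
      qed
      have \<rho>: "\<rho> (2*j+1) = 2 * swap m i j + 1"
          "\<rho> (2*j+2) = 2 * swap m i j + 2" for j
        using False by (auto simp: \<rho>_def Transposition.transpose_def)
      have "?P \<sigma>' = (\<Prod>j<n. W (\<sigma> (2 * swap m i j + 1)) (\<sigma> (2 * swap m i j + 2)))"
        using \<rho> by (simp add: \<sigma>'_def)
      also have "\<dots> = ?P \<sigma>"
        using i step(2)
        by (intro prod.reindex_bij_betw[of "swap m i" "{..<n}" "{..<n}"
              "\<lambda>j. W (\<sigma> (2*j+1)) (\<sigma> (2*j+2))"] permutes_imp_bij permutes_swap_id) auto
      finally have P: "?P \<sigma>' = ?P \<sigma>" .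
      have "\<sigma>' k = k" if "k \<le> 2*m" for k
        using that i fix' by (auto simp: \<sigma>' Transposition.transpose_def)
      moreover have "\<sigma>' (2*m+1) = 2*m+1" "\<sigma>' (2*m+2) = 2*m+2"
        using \<rho>[of m] \<sigma>i \<sigma>i2 by (simp_all add: \<sigma>'_def)
      ultimately have "\<forall>k\<le>2 * Suc m. \<sigma>' k = k"
        by (intro fixes_upto_Suc) blast+
      then have "of_int (sign \<sigma>') * ?P \<sigma>' = 1"
        by (rule step(3)[OF p2]) (simp only: P nz not_False_eq_True)
      then show ?thesis by (simp only: sgn P)
    qed
  qed
  note perm = step.prems(1) and fix' = step.prems(2) and nz = step.prems(3)
  define a where "a = inv \<sigma> (2*m+1)"
  have \<sigma>a: "\<sigma> a = 2*m+1" using permutes_inverses(1)[OF perm] by (simp add: a_def)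
  have aS: "a < 2*n+1"
    using permutes_in_image[OF permutes_inv[OF perm], of "2*m+1"] step(2) by (simp add: a_def)
  have a: "a > 2*m"
    using fix'[rule_format, of a] \<sigma>a by (cases "a \<le> 2*m") auto
  show ?case
  \<comment> \<open>Odd places come first in their pair. If \<open>a\<close> is even, its pair is
    swapped internally: the sign and, by \<open>anti\<close>, the product both change sign, and
    \<open>main\<close> applies.\<close>
  proof (cases "odd a")
    case True
    then obtain i where "a = 2*i+1" by (elim oddE)
    then show ?thesis using main[OF perm fix' nz, of i] a aS \<sigma>a by auto
  next
    case False
    then obtain i where i: "a = 2*i+2"
      using pos_nat_parity[of a] a by auto
    then have im: "m \<le> i" "i < n" using a aS by auto
    define \<sigma>' where "\<sigma>' = \<sigma> \<circ> swap (2*i+1) (2*i+2)"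
    have p: "\<sigma>' permutes ?S"
      unfolding \<sigma>'_def using im by (intro permutes_compose[OF permutes_swap_id perm]) auto
    have sgn: "sign \<sigma>' = - sign \<sigma>"
      unfolding \<sigma>'_def using im by (intro sign_comp_swap[OF perm]) auto
    have other: "\<sigma>' (2*j+1) = \<sigma> (2*j+1) \<and> \<sigma>' (2*j+2) = \<sigma> (2*j+2)" if "j \<noteq> i" for j
      using that by (auto simp: \<sigma>'_def Transposition.transpose_def)
    have pair: "\<sigma>' (2*i+1) = \<sigma> (2*i+2)" "\<sigma>' (2*i+2) = \<sigma> (2*i+1)"
      by (simp_all add: \<sigma>'_def)
    have rem: "?P \<tau> = W (\<tau> (2*i+1)) (\<tau> (2*i+2)) * (\<Prod>j\<in>{..<n}-{i}. W (\<tau> (2*j+1)) (\<tau> (2*j+2)))" for \<tau>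
      using im by (intro prod.remove) auto
    have "(\<Prod>j\<in>{..<n}-{i}. W (\<sigma>' (2*j+1)) (\<sigma>' (2*j+2))) = (\<Prod>j\<in>{..<n}-{i}. W (\<sigma> (2*j+1)) (\<sigma> (2*j+2)))"
      using other by (intro prod.cong) auto
    then have P: "?P \<sigma>' = - ?P \<sigma>"
      unfolding rem[of \<sigma>'] rem[of \<sigma>] pair by (subst anti) simp
    have "\<sigma>' k = k" if "k \<le> 2*m" for k
      using that im fix' by (auto simp: \<sigma>'_def Transposition.transpose_def)
    then have fix'': "\<forall>k\<le>2*m. \<sigma>' k = k" by blast
    have nz': "?P \<sigma>' \<noteq> 0" using nz unfolding P neg_equal_0_iff_equal .
    have "of_int (sign \<sigma>') * ?P \<sigma>' = 1"
      by (rule main[OF p fix'' nz' im]) (use pair i \<sigma>a in simp)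
    then show ?thesis unfolding sgn P by simp
  qed
qed

text \<open>Since \<open>a\<close> vanishes on the vectors after \<open>v 0\<close>, only
  permutations fixing 0 contribute. Each of them contributes 0 or \<open>a (v 0)\<close>, and the
  identity contributes \<open>a (v 0)\<close>, so the terms cannot cancel.\<close>

lemma wedge_power_symplectic_basis:
  assumes anti: "\<And>h k. w h k = - w k h"
    and a0: "a (v 0) \<noteq> 0" and a1: "\<And>i. i < n \<Longrightarrow> a (v (2*i+1)) = 0"
    and a2: "\<And>i. i < n \<Longrightarrow> a (v (2*i+2)) = 0"
    and eo: "\<And>i j. i < n \<Longrightarrow> j < n \<Longrightarrow> w (v (2*i+1)) (v (2*j+2)) = (if i = j then 1 else 0)"
    and oo: "\<And>i j. i < n \<Longrightarrow> j < n \<Longrightarrow> w (v (2*i+1)) (v (2*j+1)) = 0"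
    and ee: "\<And>i j. i < n \<Longrightarrow> j < n \<Longrightarrow> w (v (2*i+2)) (v (2*j+2)) = 0"
  shows "wedge_power a w n v \<noteq> 0"
proof -
  let ?S = "{..<2*n+1}"
  let ?P = "\<lambda>\<sigma>. \<Prod>i<n. w (v (\<sigma> (2 * i + 1))) (v (\<sigma> (2 * i + 2)))"
  define T where "T \<sigma> = (if \<sigma> 0 = 0 then of_int (sign \<sigma>) * ?P \<sigma> else 0)" for \<sigma> :: "nat \<Rightarrow> nat"
  have summand: "of_int (sign \<sigma>) * a (v (\<sigma> 0)) * ?P \<sigma> = a (v 0) * T \<sigma>" if "\<sigma> permutes ?S" for \<sigma>
  proof (cases "\<sigma> 0 = 0")
    case False
    have "\<sigma> 0 < 2*n+1" using permutes_in_image[OF that, of 0] by simp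
    moreover obtain j where "\<sigma> 0 = 2*j+1 \<or> \<sigma> 0 = 2*j+2"
      using pos_nat_parity[OF False] by blast
    ultimately have "a (v (\<sigma> 0)) = 0" using a1[of j] a2[of j] by auto
    then show ?thesis using False by (simp add: T_def)
  qed (simp add: T_def)
  \<comment> \<open>With \<open>m = 0\<close> the fixed-point hypothesis of
    \<open>symplectic_summand\<close> is just \<open>\<sigma> 0 = 0\<close>.\<close>
  have T01: "T \<sigma> = 0 \<or> T \<sigma> = 1" if "\<sigma> permutes ?S" for \<sigma>
    using symplectic_summand[of "\<lambda>i j. w (v i) (v j)" n \<sigma> 0, OF anti eo oo ee that]
    by (auto simp: T_def)
  have Tid: "T id = 1"
  proof -
    have "(\<Prod>i<n. w (v (2*i+1)) (v (2*i+2))) = 1"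
      by (intro prod.neutral ballI) (subst eo, auto)
    then show ?thesis unfolding T_def by (simp only: id_apply sign_id of_int_1 mult_1 if_True simp_thms)
  qed
  have fin: "finite {\<sigma>. \<sigma> permutes ?S}" by (simp add: finite_permutations)
  have "T id \<le> (\<Sum>\<sigma> | \<sigma> permutes ?S. T \<sigma>)"
  proof (rule member_le_sum[OF _ _ fin])
    show "0 \<le> T \<sigma>" if "\<sigma> \<in> {\<sigma>. \<sigma> permutes ?S} - {id}" for \<sigma>
      using T01[of \<sigma>] that by auto
  qed (simp_all only: permutes_id mem_Collect_eq)
  then have pos: "(\<Sum>\<sigma> | \<sigma> permutes ?S. T \<sigma>) > 0" using Tid by simp
  have "wedge_power a w n v = (1 / 2 ^ n) * (\<Sum>\<sigma> | \<sigma> permutes ?S. a (v 0) * T \<sigma>)"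
    unfolding wedge_power_def
    by (rule arg_cong2[where f = "(*)", OF refl sum.cong[OF refl]]) (simp only: mem_Collect_eq summand)
  also have "\<dots> = (1 / 2 ^ n) * a (v 0) * (\<Sum>\<sigma> | \<sigma> permutes ?S. T \<sigma>)"
    by (simp add: sum_distrib_left mult.assoc)
  finally show ?thesis using pos a0 by simp
qed

section \<open>Planes and the differential of a plane map\<close>

lemma mem_span_pair: "u \<in> span {X, Y} \<longleftrightarrow> (\<exists>p q. u = p *\<^sub>R X + q *\<^sub>R Y)"
  by (auto simp: span_insert span_singleton image_iff diff_eq_eq add.commute)

lemma frame_coefficients_zero:
  fixes X Y :: "'v::euclidean_space"
  assumes "dim (span {X, Y}) = 2" "p *\<^sub>R X + q *\<^sub>R Y = 0"
  shows "p = 0" "q = 0"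
proof -
  have *: "p = 0" if "dim (span {X, Y}) = 2" "p *\<^sub>R X + q *\<^sub>R Y = 0" for p q and X Y :: 'v
  proof (rule ccontr)
    assume "p \<noteq> 0"
    have "p *\<^sub>R X = (- q) *\<^sub>R Y" using that(2) by (simp add: eq_neg_iff_add_eq_0)
    then have "(1 / p) *\<^sub>R (p *\<^sub>R X) = (1 / p) *\<^sub>R ((- q) *\<^sub>R Y)" by (rule arg_cong)
    then have "X = ((1 / p) * (- q)) *\<^sub>R Y" using \<open>p \<noteq> 0\<close> by simp
    then have "X \<in> span {Y}" by (metis span_base span_scale singletonI)
    then have "span {X, Y} \<subseteq> span {Y}"
      by (metis insert_subset span_superset span_minimal subspace_span)
    then have "dim (span {X, Y}) \<le> card {Y}" by (intro dim_le_card) auto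
    then show False using that(1) by simp
  qed
  show "p = 0" using * assms by blast
  show "q = 0" using *[of Y X q p] assms by (simp add: insert_commute add.commute)
qed

lemma independent_pairI:
  fixes X Y :: "'v::euclidean_space"
  assumes "\<And>p q. p *\<^sub>R X + q *\<^sub>R Y = 0 \<Longrightarrow> p = 0 \<and> q = 0"
  shows "independent {X, Y}" "X \<noteq> Y"
proof -
  show ne: "X \<noteq> Y" using assms[of 1 "-1"] by auto
  have "X \<notin> span {Y}"
  proof
    assume "X \<in> span {Y}"
    then obtain k where "X = k *\<^sub>R Y" by (auto simp: span_singleton)
    then show False using assms[of 1 "- k"] by simp
  qed
  moreover have "Y \<noteq> 0" using assms[of 0 1] by auto
  ultimately show "independent {X, Y}" using ne by (simp add: independent_insert)
qed

lemma dim_span_pair: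
  fixes X Y :: "'v::euclidean_space"
  assumes "\<And>p q. p *\<^sub>R X + q *\<^sub>R Y = 0 \<Longrightarrow> p = 0 \<and> q = 0"
  shows "dim (span {X, Y}) = 2"
proof -
  have "independent {X, Y}" by (rule independent_pairI(1)) (rule assms)
  moreover have "X \<noteq> Y" by (rule independent_pairI(2)) (rule assms)
  ultimately show ?thesis by (simp add: dim_eq_card_independent)
qed

lemma frame_linear_extension:
  fixes X Y :: "'v::euclidean_space" and a b :: "'w::real_vector"
  assumes "dim (span {X, Y}) = 2"
  obtains \<phi> where "linear \<phi>" "\<phi> X = a" "\<phi> Y = b"
proof -
  have zero: "p = 0 \<and> q = 0" if "p *\<^sub>R X + q *\<^sub>R Y = 0" for p q
    using frame_coefficients_zero[OF assms that] by simp
  have ind: "independent {X, Y}" by (rule independent_pairI(1)) (rule zero)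
  have ne: "X \<noteq> Y" by (rule independent_pairI(2)) (rule zero)
  obtain \<phi> where "linear \<phi>" "\<forall>x\<in>{X, Y}. \<phi> x = (if x = X then a else b)"
    using linear_independent_extend[OF ind, of "\<lambda>x. if x = X then a else b"] by blast
  with ne show ?thesis by (intro that[of \<phi>]) auto
qed

lemma gram_determinant_nonzero:
  fixes X Y :: "'v::euclidean_space"
  assumes "dim (span {X, Y}) = 2"
  shows "(X \<bullet> X) * (Y \<bullet> Y) - (X \<bullet> Y) * (X \<bullet> Y) \<noteq> 0"
proof
  assume G: "(X \<bullet> X) * (Y \<bullet> Y) - (X \<bullet> Y) * (X \<bullet> Y) = 0"
  \<comment> \<open>\<open>Y \<bullet> Y\<close> times the part of \<open>X\<close> orthogonal to
    \<open>Y\<close>; its squared length is \<open>Y \<bullet> Y\<close> times the Gram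
    determinant.\<close>
  let ?z = "(Y \<bullet> Y) *\<^sub>R X + (- (X \<bullet> Y)) *\<^sub>R Y"
  have "?z \<bullet> ?z = (Y \<bullet> Y) * ((X \<bullet> X) * (Y \<bullet> Y) - (X \<bullet> Y) * (X \<bullet> Y))"
    by (simp add: inner_simps inner_commute algebra_simps)
  then have "?z = 0" using G by (metis inner_eq_zero_iff mult_zero_right)
  then have "Y \<bullet> Y = 0" by (rule frame_coefficients_zero(1)[OF assms])
  then have "0 *\<^sub>R X + 1 *\<^sub>R Y = 0" by simp
  then show False using frame_coefficients_zero(2)[OF assms, of 0 1] by simp
qed

lemma span_pair_eq:
  fixes X Y :: "'v::euclidean_space"
  assumes "dim (span {X, Y}) = 2" "dim (span {X', Y'}) = 2" "X' \<in> span {X, Y}" "Y' \<in> span {X, Y}"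
  shows "span {X', Y'} = span {X, Y}"
proof (rule subspace_dim_equal)
  show "span {X', Y'} \<subseteq> span {X, Y}" using assms by (intro span_minimal) auto
qed (use assms in auto)

section \<open>Cosets of a subspace and homomorphisms to the quotient\<close>

lemma coset_eq_iff:
  fixes L :: "'v::real_vector set"
  assumes "subspace L"
  shows "(+) a ` L = (+) b ` L \<longleftrightarrow> a - b \<in> L"
proof
  assume eq: "(+) a ` L = (+) b ` L"
  have "a \<in> (+) a ` L" using subspace_0[OF assms] by force
  then show "a - b \<in> L" using eq by auto
next
  have *: "(+) a ` L \<subseteq> (+) b ` L" if "a - b \<in> L" for a b
  proof
    fix x assume "x \<in> (+) a ` L"
    then obtain w where "w \<in> L" "x = a + w" by auto
    then have "x = b + ((a - b) + w)" "(a - b) + w \<in> L"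
      using that assms by (auto intro: subspace_add)
    then show "x \<in> (+) b ` L" by blast
  qed
  assume "a - b \<in> L"
  then show "(+) a ` L = (+) b ` L"
    using *[of a b] *[of b a] subspace_neg[OF assms, of "a - b"] by auto
qed

lemma quot_hom_eq_iff:
  assumes "subspace L"
  shows "quot_hom L \<phi> = quot_hom L \<phi>' \<longleftrightarrow> (\<forall>v\<in>L. \<phi> v - \<phi>' v \<in> L)"
  using coset_eq_iff[OF assms] unfolding quot_hom_def fun_eq_iff restrict_def by metis

lemma quot_hom_eq_iff_frame:
  fixes X Y :: "'v::euclidean_space"
  assumes "linear \<phi>" "linear \<phi>'" and L: "L = span {X, Y}"
  shows "quot_hom L \<phi> = quot_hom L \<phi>' \<longleftrightarrow> \<phi> X - \<phi>' X \<in> L \<and> \<phi> Y - \<phi>' Y \<in> L"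
proof -
  have sub: "subspace L" by (simp add: L)
  have "\<phi> v - \<phi>' v \<in> L" if "\<phi> X - \<phi>' X \<in> L" "\<phi> Y - \<phi>' Y \<in> L" and v: "v \<in> L" for v
  proof -
    obtain p q where "v = p *\<^sub>R X + q *\<^sub>R Y" using v by (auto simp: L mem_span_pair)
    then have "\<phi> v - \<phi>' v = p *\<^sub>R (\<phi> X - \<phi>' X) + q *\<^sub>R (\<phi> Y - \<phi>' Y)"
      using assms by (simp add: linear_add linear_cmul algebra_simps)
    then show ?thesis using that sub by (simp add: subspace_add subspace_scale)
  qed
  moreover have "X \<in> L" "Y \<in> L" by (auto simp: L span_base)
  ultimately show ?thesis unfolding quot_hom_eq_iff[OF sub] by blast
qed

text \<open>The Gram determinant expresses the coefficients of a section in the frame as differentiable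
  functions, so differentiating them contributes only vectors of the plane itself.\<close>

lemma section_derivative_mod_plane:
  fixes X Y s :: "'e::euclidean_space \<Rightarrow> 'v::euclidean_space"
  assumes "open V" "u \<in> V"
    and X: "(X has_derivative X') (at u)" and Y: "(Y has_derivative Y') (at u)"
    and s: "(s has_derivative s') (at u)"
    and mem: "\<And>x. x \<in> V \<Longrightarrow> s x \<in> span {X x, Y x}"
    and dim: "\<And>x. x \<in> V \<Longrightarrow> dim (span {X x, Y x}) = 2"
    and su: "s u = p *\<^sub>R X u + q *\<^sub>R Y u"
  shows "s' h - (p *\<^sub>R X' h + q *\<^sub>R Y' h) \<in> span {X u, Y u}"
proof -
  define G where "G x = (X x \<bullet> X x) * (Y x \<bullet> Y x) - (X x \<bullet> Y x) * (X x \<bullet> Y x)" for x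
  have G: "G x \<noteq> 0" if "x \<in> V" for x
    unfolding G_def using gram_determinant_nonzero[OF dim[OF that]] .
  \<comment> \<open>Cramer's rule for the inner products of \<open>s x\<close> with the frame:
    \<open>P x\<close> and \<open>R x\<close> are the coefficients of \<open>s x\<close>, in a form
    that is visibly differentiable.\<close>
  define P where "P x = ((s x \<bullet> X x) * (Y x \<bullet> Y x) - (s x \<bullet> Y x) * (X x \<bullet> Y x)) / G x" for x
  define R where "R x = ((s x \<bullet> Y x) * (X x \<bullet> X x) - (s x \<bullet> X x) * (X x \<bullet> Y x)) / G x" for x
  have coef: "P x = a \<and> R x = b" if "x \<in> V" "s x = a *\<^sub>R X x + b *\<^sub>R Y x" for x a b
  proof -
    have "(s x \<bullet> X x) * (Y x \<bullet> Y x) - (s x \<bullet> Y x) * (X x \<bullet> Y x) = a * G x"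
      "(s x \<bullet> Y x) * (X x \<bullet> X x) - (s x \<bullet> X x) * (X x \<bullet> Y x) = b * G x"
      by (simp_all add: that(2) G_def inner_simps inner_commute[of "Y x" "X x"] algebra_simps)
    then show ?thesis using G[OF that(1)] by (simp add: P_def R_def)
  qed
  have "X differentiable at u" "Y differentiable at u" "s differentiable at u"
    using X Y s by (auto simp: differentiable_def)
  then have "P differentiable at u" "R differentiable at u"
    unfolding P_def R_def G_def using G[OF \<open>u \<in> V\<close>]
    by (auto simp: G_def intro!: differentiable_divide differentiable_diff differentiable_mult
        differentiable_inner)
  then obtain P' R' where P': "(P has_derivative P') (at u)" and R': "(R has_derivative R') (at u)"
    by (auto simp: differentiable_def)
  have "((\<lambda>x. P x *\<^sub>R X x + R x *\<^sub>R Y x) has_derivative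
      (\<lambda>h. (P u *\<^sub>R X' h + P' h *\<^sub>R X u) + (R u *\<^sub>R Y' h + R' h *\<^sub>R Y u))) (at u)"
    by (intro has_derivative_add has_derivative_scaleR P' R' X Y)
  then have "(s has_derivative
      (\<lambda>h. (P u *\<^sub>R X' h + P' h *\<^sub>R X u) + (R u *\<^sub>R Y' h + R' h *\<^sub>R Y u))) (at u)"
  proof (rule has_derivative_transform_within_open[OF _ assms(1,2)])
    fix x assume x: "x \<in> V"
    then obtain a b where "s x = a *\<^sub>R X x + b *\<^sub>R Y x"
      using mem[OF x] by (auto simp: mem_span_pair)
    then show "P x *\<^sub>R X x + R x *\<^sub>R Y x = s x" using coef[OF x] by simp
  qed
  then have "s' h = (P u *\<^sub>R X' h + P' h *\<^sub>R X u) + (R u *\<^sub>R Y' h + R' h *\<^sub>R Y u)"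
    using has_derivative_unique[OF s] by simp
  then have "s' h - (p *\<^sub>R X' h + q *\<^sub>R Y' h) = P' h *\<^sub>R X u + R' h *\<^sub>R Y u"
    using coef[OF assms(2) su] by (simp add: algebra_simps)
  then show ?thesis by (auto simp: mem_span_pair)
qed

text \<open>By \<open>section_derivative_mod_plane\<close> all sections through \<open>v\<close>
  have the same derivative modulo the plane, and at least one exists, namely the combination of the
  frame with constant coefficients.\<close>

lemma plane_differential_frame:
  fixes X Y :: "'e::euclidean_space \<Rightarrow> 'v::euclidean_space"
  assumes V: "open V" "u \<in> V" and sm: "smooth_on V X" "smooth_on V Y"
    and frame: "\<And>x. x \<in> V \<Longrightarrow> \<psi> x = span {X x, Y x} \<and> dim (\<psi> x) = 2"
    and \<phi>: "linear \<phi>" "\<phi> (X u) = frechet_derivative X (at u) h"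
      "\<phi> (Y u) = frechet_derivative Y (at u) h"
  shows "plane_differential \<psi> u h = quot_hom (\<psi> u) \<phi>"
proof -
  note DX = smooth_on_has_derivative[OF sm(1) V(2)] and DY = smooth_on_has_derivative[OF sm(2) V(2)]
  have \<psi>u: "\<psi> u = span {X u, Y u}" and sub: "subspace (\<psi> u)" using frame[OF V(2)] by auto
  have dim: "dim (span {X x, Y x}) = 2" if "x \<in> V" for x using frame[OF that] by metis
  have *: "{frechet_derivative s (at u) h + w | s W w.
        open W \<and> u \<in> W \<and> smooth_on W s \<and> (\<forall>x\<in>W. s x \<in> \<psi> x) \<and> s u = v \<and> w \<in> \<psi> u} =
      (+) (\<phi> v) ` \<psi> u" (is "?A = ?B") if v_mem: "v \<in> \<psi> u" for v
  proof -
    obtain p q where v: "v = p *\<^sub>R X u + q *\<^sub>R Y u"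
      using v_mem by (auto simp: \<psi>u mem_span_pair)
    have \<phi>v: "\<phi> v = p *\<^sub>R frechet_derivative X (at u) h + q *\<^sub>R frechet_derivative Y (at u) h"
      using \<phi> by (simp add: v linear_add linear_cmul)
    have "?A \<subseteq> ?B"
    proof
      fix z assume "z \<in> ?A"
      then obtain s W w where z: "z = frechet_derivative s (at u) h + w"
        and W: "open W" "u \<in> W" "smooth_on W s" "\<forall>x\<in>W. s x \<in> \<psi> x" "s u = v" "w \<in> \<psi> u" by blast
      have "frechet_derivative s (at u) h -
          (p *\<^sub>R frechet_derivative X (at u) h + q *\<^sub>R frechet_derivative Y (at u) h) \<in> span {X u, Y u}"
        by (rule section_derivative_mod_plane[of "V \<inter> W", OF _ _ DX DY
              smooth_on_has_derivative[OF W(3,2)]])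
           (use V W frame dim v in auto)
      then have "frechet_derivative s (at u) h - \<phi> v + w \<in> \<psi> u"
        using W(6) subspace_add[OF sub] unfolding \<phi>v \<psi>u by blast
      moreover have "z = \<phi> v + (frechet_derivative s (at u) h - \<phi> v + w)" using z by simp
      ultimately show "z \<in> ?B" by blast
    qed
    moreover have "?B \<subseteq> ?A"
    proof
      fix z assume "z \<in> ?B"
      then obtain w where w: "w \<in> \<psi> u" "z = \<phi> v + w" by blast
      define s where "s x = p *\<^sub>R X x + q *\<^sub>R Y x" for x
      have "(s has_derivative (\<lambda>h. p *\<^sub>R frechet_derivative X (at u) h + q *\<^sub>R frechet_derivative Y (at u) h)) (at u)"
        unfolding s_def by (intro has_derivative_add has_derivative_scaleR_right DX DY)
      then have "frechet_derivative s (at u) h = \<phi> v"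
        by (simp add: frechet_derivative_at[symmetric] \<phi>v)
      moreover have "smooth_on V s"
        unfolding s_def
        by (intro smooth_on_add smooth_on_bilinear[OF bounded_bilinear_scaleR] smooth_on_const V sm)
      moreover have "s x \<in> \<psi> x" if "x \<in> V" for x
        using frame[OF that] by (auto simp: s_def mem_span_pair)
      moreover have "s u = v" by (simp add: s_def v)
      ultimately show "z \<in> ?A"
        using V w by (intro CollectI exI[of _ s] exI[of _ V] exI[of _ w]) auto
    qed
    ultimately show ?thesis by blast
  qed
  show ?thesis
  proof
    fix v
    show "plane_differential \<psi> u h v = quot_hom (\<psi> u) \<phi> v"
      using *[of v] by (cases "v \<in> \<psi> u") (simp_all only: plane_differential_def quot_hom_def
          restrict_apply if_True if_False)
  qed
qed

section \<open>The contact form of a local frame\<close>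

text \<open>The Gram matrix of \<open>form\<close> as a linear map; the nested conditional exchanges
  the indices 0 with 1 and 2 with 3 of the two hyperbolic planes.\<close>

definition polarity :: "('n::finite \<Rightarrow> real) \<Rightarrow> 'n vec4 \<Rightarrow> 'n vec4" where
  "polarity \<epsilon> v = (\<chi> k. case k of Inl i \<Rightarrow> \<epsilon> i * v $ Inl i
     | Inr j \<Rightarrow> - v $ Inr (if j = 0 then 1 else if j = 1 then 0 else if j = 2 then 3 else 2))"

lemma form_eq_inner_polarity: "form \<epsilon> X Y = X \<bullet> polarity \<epsilon> Y"
proof -
  \<comment> \<open>Arithmetic in the type \<open>4\<close> is modulo 4, and \<open>sum_4\<close>
    writes the index 0 as 4.\<close>
  have four: "(4::4) = 0" by simp
  have "X \<bullet> polarity \<epsilon> Y = (\<Sum>k\<in>UNIV <+> UNIV. X $ k * polarity \<epsilon> Y $ k)"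
    by (simp add: inner_vec_def)
  also have "\<dots> = form \<epsilon> X Y"
    by (subst sum.Plus) (simp_all add: four form_def polarity_def sum_4 algebra_simps)
  finally show ?thesis by simp
qed

lemma linear_polarity: "linear (polarity \<epsilon>)"
  by (rule linearI) (simp_all add: polarity_def vec_eq_iff algebra_simps split: sum.split)

lemma bounded_bilinear_form: "bounded_bilinear (form \<epsilon>)"
  unfolding form_eq_inner_polarity[abs_def]
  using bounded_bilinear.comp[OF bounded_bilinear_inner bounded_linear_ident]
    linear_polarity linear_conv_bounded_linear by blast

lemma inner_polarity_commute: "u \<bullet> polarity \<epsilon> v = v \<bullet> polarity \<epsilon> u"
  unfolding form_eq_inner_polarity[symmetric] by (simp add: form_def algebra_simps)

lemma form_commute: "form \<epsilon> u v = form \<epsilon> v u"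
  by (simp add: form_eq_inner_polarity inner_polarity_commute)

text \<open>Polarization: expanding \<open>form\<close> on \<open>u + v\<close> leaves twice the
  mixed term.\<close>

lemma fano_isotropic:
  assumes "L \<in> fano \<epsilon>" "u \<in> L" "v \<in> L"
  shows "form \<epsilon> u v = 0"
proof -
  have q: "form \<epsilon> w w = 0" if "w \<in> L" for w
    using assms(1) that by (auto simp: fano_def quadric_cone_def)
  have "u + v \<in> L" using assms by (auto simp: fano_def subspace_add)
  then have "form \<epsilon> (u + v) (u + v) = 0" by (rule q)
  then show ?thesis
    using q assms(2,3) form_commute[of \<epsilon> u v]
    by (simp add: bounded_bilinear.add_left[OF bounded_bilinear_form]
        bounded_bilinear.add_right[OF bounded_bilinear_form])
qed

section \<open>Tangent space and distribution in terms of representatives\<close>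

lemma quot_hom_in_tangent_fano_iff:
  assumes "L \<in> fano \<epsilon>" "linear \<phi>"
  shows "quot_hom L \<phi> \<in> tangent_fano \<epsilon> L \<longleftrightarrow> (\<forall>v\<in>L. form \<epsilon> v (\<phi> v) = 0)"
proof -
  have sub: "subspace L" using assms(1) by (simp add: fano_def)
  have "(+) (\<phi> v) ` L \<in> (\<lambda>w. (+) w ` L) ` tangent_quadric \<epsilon> v \<longleftrightarrow> form \<epsilon> v (\<phi> v) = 0"
    if v: "v \<in> L" for v
  proof
    assume "(+) (\<phi> v) ` L \<in> (\<lambda>w. (+) w ` L) ` tangent_quadric \<epsilon> v"
    \<comment> \<open>Another representative of the coset differs by an element of \<open>L\<close>,
      on which \<open>form \<epsilon> v\<close> vanishes, so the condition can be tested on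
      \<open>\<phi> v\<close> itself.\<close>
    then obtain w where w: "form \<epsilon> v w = 0" "\<phi> v - w \<in> L"
      using coset_eq_iff[OF sub] by (auto simp: tangent_quadric_def)
    then have "form \<epsilon> v (\<phi> v - w) = 0" using fano_isotropic assms(1) v by blast
    then show "form \<epsilon> v (\<phi> v) = 0"
      using w by (simp add: bounded_bilinear.diff_right[OF bounded_bilinear_form])
  qed (auto simp: tangent_quadric_def)
  moreover have "quot_hom L \<phi> \<in> Hom_quot L" using assms(2) by (auto simp: Hom_quot_def)
  moreover have "quot_hom L \<phi> v = (+) (\<phi> v) ` L" if "v \<in> L" for v
    using that by (simp add: quot_hom_def)
  ultimately show ?thesis by (simp add: tangent_fano_def)
qed

text \<open>Tangency makes \<open>form \<epsilon> u (\<phi> v)\<close> alternating on the plane, so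
  its value on one frame decides all of them. Changing \<open>\<phi>\<close> by values in
  \<open>L\<close> has no effect because \<open>L\<close> is isotropic. Hence the quantifiers in
  \<open>tau\<close> reduce to one equation.\<close>

lemma quot_hom_in_tau_iff:
  assumes L: "L \<in> fano \<epsilon>" "L = span {X, Y}" and "linear \<phi>"
    and tangent: "quot_hom L \<phi> \<in> tangent_fano \<epsilon> L"
  shows "quot_hom L \<phi> \<in> tau \<epsilon> L \<longleftrightarrow> form \<epsilon> X (\<phi> Y) = 0"
proof
  show "quot_hom L \<phi> \<in> tau \<epsilon> L \<Longrightarrow> form \<epsilon> X (\<phi> Y) = 0"
    using assms by (auto simp: tau_def)
next
  note bil = bounded_bilinear.add_left[OF bounded_bilinear_form]
    bounded_bilinear.add_right[OF bounded_bilinear_form]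
    bounded_bilinear.diff_right[OF bounded_bilinear_form]
    bounded_bilinear.scaleR_left[OF bounded_bilinear_form]
    bounded_bilinear.scaleR_right[OF bounded_bilinear_form]
  have sub: "subspace L" using L by simp
  have tv: "form \<epsilon> v (\<phi> v) = 0" if "v \<in> L" for v
    using quot_hom_in_tangent_fano_iff[OF L(1) assms(3)] tangent that by blast
  assume XY: "form \<epsilon> X (\<phi> Y) = 0"
  have XL: "X \<in> L" "Y \<in> L" by (auto simp: L span_base)
  have "form \<epsilon> (X + Y) (\<phi> (X + Y)) = 0" using XL sub by (intro tv subspace_add)
  then have YX: "form \<epsilon> Y (\<phi> X) = 0"
    using XY tv XL assms(3) by (simp add: bil linear_add)
  have zero: "form \<epsilon> u (\<phi> v) = 0" if u: "u \<in> L" and v: "v \<in> L" for u v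
  proof -
    obtain a b c d where "u = a *\<^sub>R X + b *\<^sub>R Y" "v = c *\<^sub>R X + d *\<^sub>R Y"
      using u v by (auto simp: L mem_span_pair)
    then show ?thesis
      using XY YX tv XL assms(3) by (simp add: bil linear_add linear_cmul)
  qed
  have "form \<epsilon> X' (\<phi>' Y') = 0"
    if "linear \<phi>'" "quot_hom L \<phi> = quot_hom L \<phi>'" "span {X', Y'} = L" for \<phi>' X' Y'
  proof -
    have mem: "X' \<in> L" "Y' \<in> L" using that(3) by (auto simp: span_base)
    then have "\<phi> Y' - \<phi>' Y' \<in> L" using that(2) quot_hom_eq_iff[OF sub] by blast
    then have "form \<epsilon> X' (\<phi> Y' - \<phi>' Y') = 0" using fano_isotropic[OF L(1)] mem by blast
    then show ?thesis using zero[OF mem] by (simp add: bil)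
  qed
  then show "quot_hom L \<phi> \<in> tau \<epsilon> L" using tangent by (auto simp: tau_def)
qed

lemmas form_bilinear =
  bounded_bilinear.add_left[OF bounded_bilinear_form]
  bounded_bilinear.add_right[OF bounded_bilinear_form]
  bounded_bilinear.diff_left[OF bounded_bilinear_form]
  bounded_bilinear.diff_right[OF bounded_bilinear_form]
  bounded_bilinear.minus_left[OF bounded_bilinear_form]
  bounded_bilinear.minus_right[OF bounded_bilinear_form]
  bounded_bilinear.scaleR_left[OF bounded_bilinear_form]
  bounded_bilinear.scaleR_right[OF bounded_bilinear_form]
  bounded_bilinear.zero_left[OF bounded_bilinear_form]
  bounded_bilinear.zero_right[OF bounded_bilinear_form]

lemma fano_orthonormal_frame:
  assumes "L \<in> fano \<epsilon>"
  obtains X Y where "L = span {X, Y}" "X \<bullet> X = 1" "Y \<bullet> Y = 1" "X \<bullet> Y = 0"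
proof -
  have "subspace L" "dim L = 2" using assms by (auto simp: fano_def)
  then obtain B where B: "pairwise orthogonal B" "\<And>x. x \<in> B \<Longrightarrow> norm x = 1" "card B = 2" "span B = L"
    using orthonormal_basis_subspace by metis
  then obtain X Y where XY: "B = {X, Y}" "X \<noteq> Y" by (auto simp: card_2_iff)
  show ?thesis
  proof (rule that)
    show "X \<bullet> X = 1" "Y \<bullet> Y = 1" using B(2) XY(1) by (auto simp: norm_eq_1[symmetric])
    show "X \<bullet> Y = 0" using B(1) XY by (auto simp: pairwise_def orthogonal_def)
  qed (use B XY in auto)
qed

text \<open>For isotropic \<open>L\<close> the quotient of the orthogonal space of \<open>L\<close> (with respect to \<open>form\<close>) by
  \<open>L\<close> is represented by the following subspace.\<close>

definition complement :: "('n::finite \<Rightarrow> real) \<Rightarrow> 'n vec4 set \<Rightarrow> 'n vec4 set" where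
  "complement \<epsilon> L = {v. \<forall>u\<in>L. u \<bullet> v = 0 \<and> form \<epsilon> u v = 0}"

lemma subspace_complement: "subspace (complement \<epsilon> L)"
  by (auto simp: subspace_def complement_def inner_simps form_bilinear)

text \<open>\<open>form\<close> vanishes on \<open>L\<close> and between \<open>L\<close> and its
  complement, so it descends to classes modulo \<open>L\<close>. Derivatives of a frame are
  controlled only up to such classes.\<close>

lemma form_cong_mod_fano:
  assumes L: "L \<in> fano \<epsilon>" and ab: "a \<in> complement \<epsilon> L" "b \<in> complement \<epsilon> L"
    and pq: "p - a \<in> L" "q - b \<in> L"
  shows "form \<epsilon> p q = form \<epsilon> a b"
proof -
  have "form \<epsilon> (p - a) (q - b) = 0" using fano_isotropic[OF L pq] .
  moreover have "form \<epsilon> (p - a) b = 0" using ab pq by (auto simp: complement_def)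
  moreover have "form \<epsilon> a (q - b) = 0"
    using ab pq form_commute[of \<epsilon> a] by (auto simp: complement_def)
  ultimately show ?thesis by (simp add: form_bilinear)
qed

lemma plane_differential_tau_iff:
  assumes V: "open V" "x \<in> V" "smooth_on V X" "smooth_on V Y"
    and frame: "\<And>y. y \<in> V \<Longrightarrow> \<psi> y = span {X y, Y y} \<and> dim (\<psi> y) = 2"
    and "\<psi> x \<in> fano \<epsilon>" "plane_differential \<psi> x h \<in> tangent_fano \<epsilon> (\<psi> x)"
  shows "plane_differential \<psi> x h \<in> tau \<epsilon> (\<psi> x) \<longleftrightarrow>
    form \<epsilon> (X x) (frechet_derivative Y (at x) h) = 0"
proof -
  have \<psi>x: "\<psi> x = span {X x, Y x}" and dim: "dim (span {X x, Y x}) = 2"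
    using frame[OF V(2)] by metis+
  obtain \<phi> where \<phi>: "linear \<phi>" "\<phi> (X x) = frechet_derivative X (at x) h"
      "\<phi> (Y x) = frechet_derivative Y (at x) h"
    using frame_linear_extension[OF dim] .
  have "plane_differential \<psi> x h = quot_hom (\<psi> x) \<phi>"
    by (rule plane_differential_frame[OF V frame \<phi>])
  then show ?thesis
    using quot_hom_in_tau_iff[OF assms(6) \<psi>x \<phi>(1)] assms(7) \<phi>(3) by simp
qed

text \<open>Surjectivity of the differential, read on the frame. In an arbitrary chart this is the
  source of directions along which the derivatives of \<open>X\<close> and \<open>Y\<close> are
  prescribed modulo the plane.\<close>

lemma tangent_vector_realized:
  assumes V: "open V" "x \<in> V" "smooth_on V X" "smooth_on V Y"
    and frame: "\<And>y. y \<in> V \<Longrightarrow> \<psi> y = span {X y, Y y} \<and> dim (\<psi> y) = 2"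
    and L: "\<psi> x \<in> fano \<epsilon>" and surj: "range (plane_differential \<psi> x) = tangent_fano \<epsilon> (\<psi> x)"
    and \<phi>: "linear \<phi>" "\<And>v. v \<in> \<psi> x \<Longrightarrow> form \<epsilon> v (\<phi> v) = 0"
  obtains h where "frechet_derivative X (at x) h - \<phi> (X x) \<in> \<psi> x"
    "frechet_derivative Y (at x) h - \<phi> (Y x) \<in> \<psi> x"
proof -
  have \<psi>x: "\<psi> x = span {X x, Y x}" and dim: "dim (span {X x, Y x}) = 2"
    using frame[OF V(2)] by metis+
  have "quot_hom (\<psi> x) \<phi> \<in> range (plane_differential \<psi> x)"
    unfolding surj using quot_hom_in_tangent_fano_iff[OF L \<phi>(1)] \<phi>(2) by blast
  then obtain h where h: "quot_hom (\<psi> x) \<phi> = plane_differential \<psi> x h" by blast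
  obtain \<phi>' where \<phi>': "linear \<phi>'" "\<phi>' (X x) = frechet_derivative X (at x) h"
      "\<phi>' (Y x) = frechet_derivative Y (at x) h"
    using frame_linear_extension[OF dim] .
  have "quot_hom (\<psi> x) \<phi>' = quot_hom (\<psi> x) \<phi>"
    using plane_differential_frame[OF V frame \<phi>'] h by simp
  then show ?thesis
    using quot_hom_eq_iff_frame[OF \<phi>'(1) \<phi>(1) \<psi>x] \<phi>' that by metis
qed

text \<open>By the symmetry of second derivatives, the second derivatives of the frame cancel.\<close>

lemma ext_deriv_frame_form:
  fixes X Y :: "'e::euclidean_space \<Rightarrow> 'n::finite vec4"
  assumes V: "open V" "x \<in> V" "smooth_on V X" "smooth_on V Y"
  shows "ext_deriv (\<lambda>y h. form \<epsilon> (X y) (frechet_derivative Y (at y) h)) x h k =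
    form \<epsilon> (frechet_derivative X (at x) h) (frechet_derivative Y (at x) k) -
    form \<epsilon> (frechet_derivative X (at x) k) (frechet_derivative Y (at x) h)"
proof -
  have "frechet_derivative (\<lambda>y. form \<epsilon> (X y) (frechet_derivative Y (at y) k)) (at x) h =
      form \<epsilon> (X x) (frechet_derivative (\<lambda>y. frechet_derivative Y (at y) k) (at x) h) +
      form \<epsilon> (frechet_derivative X (at x) h) (frechet_derivative Y (at x) k)" for h k
    by (subst frechet_derivative_at[symmetric, OF bounded_bilinear.FDERIV[OF bounded_bilinear_form
          smooth_on_has_derivative[OF V(3,2)]
          smooth_on_has_derivative[OF smooth_on_frechet_derivative[OF V(4)] V(2)]]]) simp
  then show ?thesis
    unfolding ext_deriv_def using second_derivative_symmetric[OF V(1,4,2), of h k] by simp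
qed

section \<open>Nondegeneracy of the form\<close>

locale unit_signs =
  fixes \<epsilon> :: "'n::finite \<Rightarrow> real"
  assumes sign: "\<And>i. \<epsilon> i = 1 \<or> \<epsilon> i = - 1"
begin

text \<open>The signs enter through \<open>\<epsilon> i * \<epsilon> i = 1\<close>; on the last four
  coordinates two pairs are exchanged with sign -1.\<close>

lemma polarity_polarity: "polarity \<epsilon> (polarity \<epsilon> v) = v"
proof -
  have four: "(4::4) = 0" by simp
  have "polarity \<epsilon> (polarity \<epsilon> v) $ k = v $ k" for k
  proof (cases k)
    case (Inl i)
    then show ?thesis using sign[of i] by (auto simp: polarity_def)
  next
    case (Inr j)
    then show ?thesis using exhaust_4[of j] by (auto simp: polarity_def four)
  qed
  then show ?thesis by (simp add: vec_eq_iff)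
qed

lemma form_polarity: "form \<epsilon> u (polarity \<epsilon> v) = u \<bullet> v" "form \<epsilon> (polarity \<epsilon> u) v = u \<bullet> v"
  using form_commute[of \<epsilon> "polarity \<epsilon> u" v]
  by (simp_all add: form_eq_inner_polarity polarity_polarity inner_commute)

lemma polarity_complement: "v \<in> complement \<epsilon> L \<Longrightarrow> polarity \<epsilon> v \<in> complement \<epsilon> L"
  by (simp add: complement_def form_polarity flip: form_eq_inner_polarity)

text \<open>Isotropy of \<open>L\<close> says that \<open>L\<close> is Euclidean orthogonal to its
  polar image, so an orthonormal frame and its polar image are four orthonormal vectors.
  \<open>complement\<close> is the orthogonal complement of their span in dimension
  \<open>n + 4\<close>.\<close>

lemma dim_complement:
  assumes "L \<in> fano \<epsilon>"
  shows "dim (complement \<epsilon> L) = CARD('n)"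
proof -
  obtain X Y where XY: "L = span {X, Y}" "X \<bullet> X = 1" "Y \<bullet> Y = 1" "X \<bullet> Y = 0"
    using fano_orthonormal_frame[OF assms] .
  have "X \<in> L" "Y \<in> L" by (auto simp: XY span_base)
  then have iso: "form \<epsilon> X X = 0" "form \<epsilon> X Y = 0" "form \<epsilon> Y X = 0" "form \<epsilon> Y Y = 0"
    using fano_isotropic[OF assms] by blast+
  let ?P = "polarity \<epsilon>" let ?A = "{X, Y, ?P X, ?P Y}"
  have inner: "Y \<bullet> X = 0" "X \<bullet> ?P X = 0" "X \<bullet> ?P Y = 0" "Y \<bullet> ?P X = 0" "Y \<bullet> ?P Y = 0"
      "?P X \<bullet> X = 0" "?P X \<bullet> Y = 0" "?P Y \<bullet> X = 0" "?P Y \<bullet> Y = 0"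
      "?P X \<bullet> ?P Y = 0" "?P Y \<bullet> ?P X = 0" "?P X \<bullet> ?P X = 1" "?P Y \<bullet> ?P Y = 1"
    using XY iso form_polarity(2)[of X] form_polarity(2)[of Y]
    by (simp_all add: form_eq_inner_polarity inner_commute)
  have "pairwise orthogonal ?A" by (auto simp: pairwise_insert orthogonal_def XY inner)
  moreover have "0 \<notin> ?A" using XY(2,3) inner(12,13) by auto
  ultimately have "independent ?A" by (rule pairwise_orthogonal_independent)
  moreover have "X \<noteq> Y" "X \<noteq> ?P X" "X \<noteq> ?P Y" "Y \<noteq> ?P X" "Y \<noteq> ?P Y" "?P X \<noteq> ?P Y"
    using XY(2-4) inner by (metis zero_neq_one)+
  then have "card ?A = 4" by simp
  ultimately have dim: "dim (span ?A) = 4" by (simp add: dim_eq_card_independent)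
  have "complement \<epsilon> L = {y \<in> UNIV. \<forall>x\<in>span ?A. orthogonal x y}" (is "_ = ?R")
  proof (intro equalityI subsetI)
    fix v assume v: "v \<in> complement \<epsilon> L"
    have "orthogonal v x" if "x \<in> ?A" for x
      using that v \<open>X \<in> L\<close> \<open>Y \<in> L\<close> form_commute[of \<epsilon> v]
      by (auto simp: complement_def orthogonal_def inner_commute simp flip: form_eq_inner_polarity)
    then have "orthogonal v x" if "x \<in> span ?A" for x using orthogonal_to_span that by blast
    then show "v \<in> ?R" by (simp add: orthogonal_commute)
  next
    fix v assume v: "v \<in> ?R"
    have "u \<bullet> v = 0 \<and> form \<epsilon> u v = 0" if u_mem: "u \<in> L" for u
    proof -
      obtain p q where u: "u = p *\<^sub>R X + q *\<^sub>R Y" using u_mem by (auto simp: XY(1) mem_span_pair)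
      have "x \<bullet> v = 0" if "x \<in> ?A" for x
        using v span_base[OF that] unfolding orthogonal_def by blast
      moreover have "form \<epsilon> w v = ?P w \<bullet> v" for w
        by (metis form_eq_inner_polarity inner_commute inner_polarity_commute)
      ultimately show ?thesis by (simp add: u inner_simps form_bilinear)
    qed
    then show "v \<in> complement \<epsilon> L" by (simp add: complement_def)
  qed
  moreover have "dim ?R + dim (span ?A) = dim (UNIV :: 'n vec4 set)"
    by (rule dim_subspace_orthogonal_to_vectors) auto
  ultimately show ?thesis using dim by simp
qed

lemma complement_orthonormal_basis:
  assumes "L \<in> fano \<epsilon>"
  obtains e :: "nat \<Rightarrow> 'n vec4" where "\<And>i. i < CARD('n) \<Longrightarrow> e i \<in> complement \<epsilon> L"
    "\<And>i j. i < CARD('n) \<Longrightarrow> j < CARD('n) \<Longrightarrow> e i \<bullet> e j = (if i = j then 1 else 0)"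
proof -
  obtain B where B: "B \<subseteq> complement \<epsilon> L" "pairwise orthogonal B" "\<And>x. x \<in> B \<Longrightarrow> norm x = 1"
      "independent B" "card B = CARD('n)"
    using orthonormal_basis_subspace[OF subspace_complement, of \<epsilon> L] dim_complement[OF assms] by metis
  have "finite B" using B(4) by (rule independent_imp_finite)
  then obtain e where e: "bij_betw e {0..<CARD('n)} B"
    using ex_bij_betw_nat_finite B(5) by metis
  then have mem: "e i \<in> B" if "i < CARD('n)" for i using that by (auto simp: bij_betw_def)
  show ?thesis
  proof (rule that)
    show "e i \<in> complement \<epsilon> L" if "i < CARD('n)" for i using mem[OF that] B(1) by auto
    fix i j assume ij: "i < CARD('n)" "j < CARD('n)"
    show "e i \<bullet> e j = (if i = j then 1 else 0)"
    proof (cases "i = j")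
      case True
      then show ?thesis using B(3)[OF mem[OF ij(1)]] by (simp add: norm_eq_1)
    next
      case False
      then have "e i \<noteq> e j" using e ij by (auto simp: bij_betw_def inj_on_def)
      then show ?thesis using B(2) mem[OF ij(1)] mem[OF ij(2)] False
        by (auto simp: pairwise_def orthogonal_def)
    qed
  qed
qed

section \<open>The contact condition in a local frame\<close>

lemma frame_form_contact:
  fixes \<psi> :: "real ^ ('n + 'n + 1) \<Rightarrow> 'n vec4 set"
  assumes V: "open V" "smooth_on V X" "smooth_on V Y"
    and frame: "\<And>y. y \<in> V \<Longrightarrow> \<psi> y = span {X y, Y y} \<and> dim (\<psi> y) = 2"
    and L: "\<And>y. y \<in> V \<Longrightarrow> \<psi> y \<in> fano \<epsilon>"
    and surj: "\<And>y. y \<in> V \<Longrightarrow> range (plane_differential \<psi> y) = tangent_fano \<epsilon> (\<psi> y)"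
  shows "contact_form_on V (\<lambda>y h. form \<epsilon> (X y) (frechet_derivative Y (at y) h))"
proof -
  let ?\<alpha> = "\<lambda>y h. form \<epsilon> (X y) (frechet_derivative Y (at y) h)"
  let ?n = "CARD('n)"
  have "linear (?\<alpha> y)" if "y \<in> V" for y
  proof -
    have "linear (frechet_derivative Y (at y))"
      using smooth_on_has_derivative[OF V(3) that] by (rule has_derivative_linear)
    then show ?thesis by (intro linearI) (simp_all add: linear_add linear_cmul form_bilinear)
  qed
  moreover have "smooth_on V (\<lambda>y. ?\<alpha> y h)" for h
    by (intro smooth_on_bilinear[OF bounded_bilinear_form] V smooth_on_frechet_derivative)
  ultimately have "smooth_one_form_on V ?\<alpha>" by (simp add: smooth_one_form_on_def)
  moreover have "\<exists>v. wedge_power (?\<alpha> x) (ext_deriv ?\<alpha> x) ?n v \<noteq> 0" if x: "x \<in> V" for x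
  proof -
    let ?DX = "frechet_derivative X (at x)" let ?DY = "frechet_derivative Y (at x)"
    let ?E = "complement \<epsilon> (\<psi> x)"
    have \<psi>x: "\<psi> x = span {X x, Y x}" and dim: "dim (span {X x, Y x}) = 2"
      using frame[OF x] by metis+
    then have XY: "X x \<in> \<psi> x" "Y x \<in> \<psi> x" by (auto simp: span_base)
    have realize: "\<exists>h. ?DX h - \<phi> (X x) \<in> \<psi> x \<and> ?DY h - \<phi> (Y x) \<in> \<psi> x"
      if tangent: "linear \<phi>" "\<And>v. v \<in> \<psi> x \<Longrightarrow> form \<epsilon> v (\<phi> v) = 0" for \<phi>
    proof -
      obtain h where "?DX h - \<phi> (X x) \<in> \<psi> x" "?DY h - \<phi> (Y x) \<in> \<psi> x"
        by (rule tangent_vector_realized[OF V(1) x V(2,3) frame L[OF x] surj[OF x] tangent])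
      then show ?thesis by blast
    qed
    \<comment> \<open>A homomorphism with values in \<open>?E\<close> is tangent because
      \<open>form\<close> vanishes between the plane and \<open>?E\<close>.\<close>
    have pair: "\<exists>h. ?DX h - a \<in> \<psi> x \<and> ?DY h - b \<in> \<psi> x" if ab: "a \<in> ?E" "b \<in> ?E" for a b
    proof -
      obtain \<phi> where \<phi>: "linear \<phi>" "\<phi> (X x) = a" "\<phi> (Y x) = b"
        using frame_linear_extension[OF dim] .
      have "form \<epsilon> v (\<phi> v) = 0" if v: "v \<in> \<psi> x" for v
      proof -
        obtain p q where pq: "v = p *\<^sub>R X x + q *\<^sub>R Y x" using v by (auto simp: \<psi>x mem_span_pair)
        have "\<phi> v = p *\<^sub>R a + q *\<^sub>R b" using \<phi> by (simp add: pq linear_add linear_cmul)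
        moreover have "\<dots> \<in> ?E"
          using ab subspace_complement by (intro subspace_add subspace_scale) auto
        ultimately show ?thesis using v by (auto simp: complement_def)
      qed
      then show ?thesis using realize[OF \<phi>(1)] \<phi> by metis
    qed
    obtain e where eE: "\<And>i. i < ?n \<Longrightarrow> e i \<in> ?E"
      and ee: "\<And>i j. i < ?n \<Longrightarrow> j < ?n \<Longrightarrow> e i \<bullet> e j = (if i = j then 1 else 0)"
      using complement_orthonormal_basis[OF L[OF x]] by metis
    have zE: "0 \<in> ?E" using subspace_complement by (rule subspace_0)
    have JE: "polarity \<epsilon> (e i) \<in> ?E" if "i < ?n" for i using eE[OF that] by (rule polarity_complement)
    \<comment> \<open>\<open>s i\<close> and \<open>t i\<close> will represent
      \<open>(e i, 0)\<close> and \<open>(0, polarity \<epsilon> (e i))\<close>; Euclidean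
      orthonormality of \<open>e\<close> becomes duality under \<open>form\<close>.\<close>
    have "\<forall>i. \<exists>h. i < ?n \<longrightarrow> ?DX h - e i \<in> \<psi> x \<and> ?DY h - 0 \<in> \<psi> x"
      using pair[OF eE zE] by blast
    then obtain s where s: "\<And>i. i < ?n \<Longrightarrow> ?DX (s i) - e i \<in> \<psi> x \<and> ?DY (s i) - 0 \<in> \<psi> x" by metis
    have "\<forall>i. \<exists>h. i < ?n \<longrightarrow> ?DX h - 0 \<in> \<psi> x \<and> ?DY h - polarity \<epsilon> (e i) \<in> \<psi> x"
      using pair[OF zE JE] by blast
    then obtain t where t: "\<And>i. i < ?n \<Longrightarrow> ?DX (t i) - 0 \<in> \<psi> x \<and> ?DY (t i) - polarity \<epsilon> (e i) \<in> \<psi> x"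
      by metis
    \<comment> \<open>A direction transverse to the kernel:
      \<open>form \<epsilon> v (\<phi> v)\<close> cancels identically, while
      \<open>form \<epsilon> (X x) (\<phi> (Y x))\<close> is minus the Gram determinant of the
      frame, which need not be orthonormal.\<close>
    define \<phi> where "\<phi> v = (v \<bullet> X x) *\<^sub>R polarity \<epsilon> (Y x) - (v \<bullet> Y x) *\<^sub>R polarity \<epsilon> (X x)" for v
    have "linear \<phi>" unfolding \<phi>_def by (rule linearI) (simp_all add: inner_simps algebra_simps)
    moreover have "form \<epsilon> v (\<phi> v) = 0" for v
      by (simp add: \<phi>_def form_bilinear form_polarity)
    ultimately obtain r where r: "?DY r - \<phi> (Y x) \<in> \<psi> x" using realize by metis
    \<comment> \<open>The order expected by \<open>wedge_power\<close>: \<open>r\<close> at place 0,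
      then \<open>s i\<close> and \<open>t i\<close> as pair \<open>i\<close> at the places
      \<open>2*i+1\<close> and \<open>2*i+2\<close>.\<close>
    define v where "v k = (if k = 0 then r else if odd k then s (k div 2) else t (k div 2 - 1))" for k
    have v: "v 0 = r" "v (2*i+1) = s i" "v (2*i+2) = t i" for i
      by (simp_all add: v_def)
    have \<alpha>E: "?\<alpha> x h = 0" if "b \<in> ?E" "?DY h - b \<in> \<psi> x" for h b
    proof -
      have "form \<epsilon> (X x) (?DY h - b) = 0" using fano_isotropic[OF L[OF x]] XY that by blast
      moreover have "form \<epsilon> (X x) b = 0" using that XY by (auto simp: complement_def)
      ultimately show ?thesis by (simp add: form_bilinear)
    qed
    have d\<alpha>: "ext_deriv ?\<alpha> x h k = form \<epsilon> a b' - form \<epsilon> a' b"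
      if "?DX h - a \<in> \<psi> x \<and> ?DY h - b \<in> \<psi> x" "?DX k - a' \<in> \<psi> x \<and> ?DY k - b' \<in> \<psi> x"
        "a \<in> ?E" "b \<in> ?E" "a' \<in> ?E" "b' \<in> ?E" for h k a b a' b'
    proof -
      have "form \<epsilon> (?DX h) (?DY k) = form \<epsilon> a b'" "form \<epsilon> (?DX k) (?DY h) = form \<epsilon> a' b"
        using that by (auto intro: form_cong_mod_fano[OF L[OF x]])
      then show ?thesis by (simp only: ext_deriv_frame_form[OF V(1) x V(2,3)])
    qed
    have "wedge_power (?\<alpha> x) (ext_deriv ?\<alpha> x) ?n v \<noteq> 0"
    proof (rule wedge_power_symplectic_basis)
      show "ext_deriv ?\<alpha> x h k = - ext_deriv ?\<alpha> x k h" for h k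
        by (simp add: ext_deriv_def)
      have "form \<epsilon> (X x) (?DY r - \<phi> (Y x)) = 0" using fano_isotropic[OF L[OF x]] XY r by blast
      then have "?\<alpha> x r = - ((X x \<bullet> X x) * (Y x \<bullet> Y x) - (X x \<bullet> Y x) * (X x \<bullet> Y x))"
        by (simp add: \<phi>_def form_bilinear form_polarity inner_commute)
      then show "?\<alpha> x (v 0) \<noteq> 0" using gram_determinant_nonzero[OF dim] v by simp
      show "?\<alpha> x (v (2*i+1)) = 0" "?\<alpha> x (v (2*i+2)) = 0" if "i < ?n" for i
        unfolding v using \<alpha>E[OF zE conjunct2[OF s[OF that]]] \<alpha>E[OF JE[OF that] conjunct2[OF t[OF that]]]
        by simp_all
      fix i j assume ij: "i < ?n" "j < ?n"
      show "ext_deriv ?\<alpha> x (v (2*i+1)) (v (2*j+2)) = (if i = j then 1 else 0)"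
        unfolding v d\<alpha>[OF s[OF ij(1)] t[OF ij(2)] eE[OF ij(1)] zE zE JE[OF ij(2)]]
        using ij by (simp add: form_bilinear form_polarity ee)
      show "ext_deriv ?\<alpha> x (v (2*i+1)) (v (2*j+1)) = 0"
        unfolding v d\<alpha>[OF s[OF ij(1)] s[OF ij(2)] eE[OF ij(1)] zE eE[OF ij(2)] zE]
        by (simp add: form_bilinear)
      show "ext_deriv ?\<alpha> x (v (2*i+2)) (v (2*j+2)) = 0"
        unfolding v d\<alpha>[OF t[OF ij(1)] t[OF ij(2)] zE JE[OF ij(1)] zE JE[OF ij(2)]]
        by (simp add: form_bilinear)
    qed
    then show ?thesis by blast
  qed
  moreover have "DIM(real ^ ('n + 'n + 1)) = 2 * ?n + 1" by simp
  ultimately show ?thesis unfolding contact_form_on_def by blast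
qed

text \<open>On the neighbourhood supplied by \<open>smooth_plane_map\<close>, bijectivity of the
  differential gives both the tangency that \<open>plane_differential_tau_iff\<close> requires and
  enough tangent vectors for \<open>frame_form_contact\<close>.\<close>

lemma chart_contact_distribution:
  fixes \<psi> :: "real ^ ('n + 'n + 1) \<Rightarrow> 'n vec4 set"
  assumes "fano_chart \<epsilon> U \<psi>"
  shows "contact_distribution_on U (\<lambda>u. {h. plane_differential \<psi> u h \<in> tau \<epsilon> (\<psi> u)})"
  unfolding contact_distribution_on_def
proof
  fix u assume u: "u \<in> U"
  then obtain V X Y where V: "open V" "u \<in> V" "V \<subseteq> U" "smooth_on V X" "smooth_on V Y"
    and frame: "\<And>x. x \<in> V \<Longrightarrow> \<psi> x = span {X x, Y x} \<and> dim (\<psi> x) = 2"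
    using assms unfolding fano_chart_def smooth_plane_map_def by meson
  have L: "\<psi> x \<in> fano \<epsilon>" if "x \<in> V" for x
    using assms V(3) that by (auto simp: fano_chart_def)
  have surj: "range (plane_differential \<psi> x) = tangent_fano \<epsilon> (\<psi> x)" if "x \<in> V" for x
  proof -
    have "x \<in> U" using V(3) that by blast
    then show ?thesis using assms unfolding fano_chart_def bij_betw_def by blast
  qed
  let ?\<alpha> = "\<lambda>y h. form \<epsilon> (X y) (frechet_derivative Y (at y) h)"
  have "contact_form_on V ?\<alpha>"
    by (rule frame_form_contact[OF V(1,4,5) frame L surj])
  moreover have "{h. plane_differential \<psi> x h \<in> tau \<epsilon> (\<psi> x)} = {h. ?\<alpha> x h = 0}" if x: "x \<in> V" for x
    using plane_differential_tau_iff[OF V(1) x V(4,5) frame L[OF x]] surj[OF x] by blast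
  ultimately show "\<exists>V \<alpha>. open V \<and> u \<in> V \<and> V \<subseteq> U \<and> contact_form_on V \<alpha> \<and>
      (\<forall>x\<in>V. {h. plane_differential \<psi> x h \<in> tau \<epsilon> (\<psi> x)} = {h. \<alpha> x h = 0})"
    using V by blast
qed

end

section \<open>Charts by graphs over an isotropic plane\<close>

text \<open>Graphs over the plane are parametrized by two vectors of its complement and a real
  number, while charts live on \<open>real ^ ('n + 'n + 1)\<close>; the linear maps \<open>G\<close>
  and \<open>g\<close> identify the two. \<open>X0\<close>, \<open>Y0\<close> is an orthonormal
  frame of the plane at the centre of the chart.\<close>

locale adapted_frame = unit_signs \<epsilon> for \<epsilon> :: "'n::finite \<Rightarrow> real" +
  fixes X0 Y0 :: "'n vec4"
    and G :: "real ^ ('n + 'n + 1) \<Rightarrow> 'n vec4 \<times> 'n vec4 \<times> real"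
    and g :: "'n vec4 \<times> 'n vec4 \<times> real \<Rightarrow> real ^ ('n + 'n + 1)"
  assumes fano0: "span {X0, Y0} \<in> fano \<epsilon>"
    and X0X0: "X0 \<bullet> X0 = 1" and Y0Y0: "Y0 \<bullet> Y0 = 1" and X0Y0: "X0 \<bullet> Y0 = 0"
    and linear_G: "linear G" and linear_g: "linear g"
    and G_mem: "G x \<in> complement \<epsilon> (span {X0, Y0}) \<times> complement \<epsilon> (span {X0, Y0}) \<times> UNIV"
    and g_G: "g (G x) = x"
    and G_g: "y \<in> complement \<epsilon> (span {X0, Y0}) \<times> complement \<epsilon> (span {X0, Y0}) \<times> UNIV \<Longrightarrow> G (g y) = y"
begin

abbreviation "E \<equiv> complement \<epsilon> (span {X0, Y0})"
abbreviation "Z0 \<equiv> polarity \<epsilon> X0"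
abbreviation "W0 \<equiv> polarity \<epsilon> Y0"

definition e where "e x = fst (G x)"
definition f where "f x = fst (snd (G x))"
definition b where "b x = snd (snd (G x))"

text \<open>The coefficients of \<open>Z0\<close> and \<open>W0\<close> solve the equations of an isotropic plane, up to the
  free parameter \<open>b\<close>.\<close>

definition X where "X x = X0 + e x - (form \<epsilon> (e x) (e x) / 2) *\<^sub>R Z0 + b x *\<^sub>R W0"
definition Y where
  "Y x = Y0 + f x - (b x + form \<epsilon> (e x) (f x)) *\<^sub>R Z0 - (form \<epsilon> (f x) (f x) / 2) *\<^sub>R W0"

text \<open>The differentials of \<open>X\<close> and \<open>Y\<close> at \<open>x\<close>, as
  \<open>X_has_derivative\<close> and \<open>Y_has_derivative\<close> confirm; symmetry of
  \<open>form\<close> absorbs the factor 1/2 of the quadratic terms.\<close>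

definition DX where "DX x h = e h - form \<epsilon> (e x) (e h) *\<^sub>R Z0 + b h *\<^sub>R W0"
definition DY where
  "DY x h = f h - (b h + form \<epsilon> (e x) (f h) + form \<epsilon> (e h) (f x)) *\<^sub>R Z0 - form \<epsilon> (f x) (f h) *\<^sub>R W0"

definition \<psi> where "\<psi> x = span {X x, Y x}"

lemma eE: "e x \<in> E" and fE: "f x \<in> E"
  using G_mem[of x] by (auto simp: e_def f_def mem_Times_iff)

lemma G_eq: "G x = (e x, f x, b x)"
  by (simp add: e_def f_def b_def)

lemma bounded_linear_efb: "bounded_linear e" "bounded_linear f" "bounded_linear b"
proof -
  have G: "bounded_linear G" using linear_G by (simp add: linear_conv_bounded_linear)
  show "bounded_linear e" "bounded_linear f" "bounded_linear b"
    unfolding e_def f_def b_def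
    by (auto intro!: bounded_linear_fst_comp bounded_linear_snd_comp G)
qed

section \<open>Relations among the vectors of the adapted frame\<close>

lemma X0_mem: "X0 \<in> span {X0, Y0}" and Y0_mem: "Y0 \<in> span {X0, Y0}"
  by (auto simp: span_base)

lemma form_isotropic_frame [simp]: "form \<epsilon> X0 X0 = 0" "form \<epsilon> X0 Y0 = 0"
  "form \<epsilon> Y0 X0 = 0" "form \<epsilon> Y0 Y0 = 0"
  using fano_isotropic[OF fano0] X0_mem Y0_mem by blast+

lemma inner_frame [simp]: "X0 \<bullet> X0 = 1" "Y0 \<bullet> Y0 = 1" "X0 \<bullet> Y0 = 0" "Y0 \<bullet> X0 = 0"
  "X0 \<bullet> Z0 = 0" "X0 \<bullet> W0 = 0" "Y0 \<bullet> Z0 = 0" "Y0 \<bullet> W0 = 0"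
  "Z0 \<bullet> X0 = 0" "W0 \<bullet> X0 = 0" "Z0 \<bullet> Y0 = 0" "W0 \<bullet> Y0 = 0"
  "Z0 \<bullet> Z0 = 1" "Z0 \<bullet> W0 = 0" "W0 \<bullet> Z0 = 0" "W0 \<bullet> W0 = 1"
proof -
  show a: "X0 \<bullet> X0 = 1" "Y0 \<bullet> Y0 = 1" "X0 \<bullet> Y0 = 0" "Y0 \<bullet> X0 = 0"
    using X0X0 Y0Y0 X0Y0 by (simp_all add: inner_commute)
  show "X0 \<bullet> Z0 = 0" "X0 \<bullet> W0 = 0" "Y0 \<bullet> Z0 = 0" "Y0 \<bullet> W0 = 0"
    by (simp_all flip: form_eq_inner_polarity)
  then show "Z0 \<bullet> X0 = 0" "W0 \<bullet> X0 = 0" "Z0 \<bullet> Y0 = 0" "W0 \<bullet> Y0 = 0"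
    by (simp_all add: inner_commute)
  show "Z0 \<bullet> Z0 = 1" "Z0 \<bullet> W0 = 0" "W0 \<bullet> Z0 = 0" "W0 \<bullet> W0 = 1"
    by (simp_all flip: form_eq_inner_polarity add: form_polarity a)
qed

lemma form_dual_frame [simp]: "form \<epsilon> X0 Z0 = 1" "form \<epsilon> X0 W0 = 0" "form \<epsilon> Y0 Z0 = 0" "form \<epsilon> Y0 W0 = 1"
  "form \<epsilon> Z0 X0 = 1" "form \<epsilon> W0 X0 = 0" "form \<epsilon> Z0 Y0 = 0" "form \<epsilon> W0 Y0 = 1"
  "form \<epsilon> Z0 Z0 = 0" "form \<epsilon> Z0 W0 = 0" "form \<epsilon> W0 Z0 = 0" "form \<epsilon> W0 W0 = 0"
  by (simp_all add: form_polarity)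

lemma complement_simps:
  assumes "a \<in> E"
  shows "X0 \<bullet> a = 0" "Y0 \<bullet> a = 0" "Z0 \<bullet> a = 0" "W0 \<bullet> a = 0"
    "a \<bullet> X0 = 0" "a \<bullet> Y0 = 0" "a \<bullet> Z0 = 0" "a \<bullet> W0 = 0"
    "form \<epsilon> X0 a = 0" "form \<epsilon> Y0 a = 0" "form \<epsilon> Z0 a = 0" "form \<epsilon> W0 a = 0"
    "form \<epsilon> a X0 = 0" "form \<epsilon> a Y0 = 0" "form \<epsilon> a Z0 = 0" "form \<epsilon> a W0 = 0"
proof -
  show 1: "X0 \<bullet> a = 0" "Y0 \<bullet> a = 0" "form \<epsilon> X0 a = 0" "form \<epsilon> Y0 a = 0"
    using assms X0_mem Y0_mem by (auto simp: complement_def)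
  then show 2: "form \<epsilon> a X0 = 0" "form \<epsilon> a Y0 = 0" using form_commute by metis+
  then show 3: "a \<bullet> Z0 = 0" "a \<bullet> W0 = 0" by (simp_all add: form_eq_inner_polarity)
  show 4: "a \<bullet> X0 = 0" "a \<bullet> Y0 = 0" "Z0 \<bullet> a = 0" "W0 \<bullet> a = 0"
    using 1 3 by (simp_all add: inner_commute)
  show "form \<epsilon> Z0 a = 0" "form \<epsilon> W0 a = 0" "form \<epsilon> a Z0 = 0" "form \<epsilon> a W0 = 0"
    using 1 4 by (simp_all add: form_polarity)
qed

lemmas e_simps [simp] = complement_simps[OF eE]
lemmas f_simps [simp] = complement_simps[OF fE]

text \<open>Euclidean orthogonal projection to \<open>E\<close>, since \<open>X0\<close>,
  \<open>Y0\<close>, \<open>Z0\<close>, \<open>W0\<close> are orthonormal and orthogonal to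
  \<open>E\<close>.\<close>

definition proj where
  "proj v = v - (v \<bullet> X0) *\<^sub>R X0 - (v \<bullet> Y0) *\<^sub>R Y0 - (v \<bullet> Z0) *\<^sub>R Z0 - (v \<bullet> W0) *\<^sub>R W0"

lemma proj_mem: "proj v \<in> E"
proof -
  have XY: "X0 \<bullet> proj v = 0" "Y0 \<bullet> proj v = 0" "form \<epsilon> X0 (proj v) = 0" "form \<epsilon> Y0 (proj v) = 0"
    using form_commute[of \<epsilon> X0 v] form_commute[of \<epsilon> Y0 v]
    by (simp_all add: proj_def inner_simps form_bilinear inner_commute[of _ v]
        flip: form_eq_inner_polarity)
  have "u \<bullet> proj v = 0 \<and> form \<epsilon> u (proj v) = 0" if u_mem: "u \<in> span {X0, Y0}" for u
  proof -
    obtain p q where "u = p *\<^sub>R X0 + q *\<^sub>R Y0" using u_mem by (auto simp: mem_span_pair)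
    then show ?thesis using XY by (simp add: inner_simps form_bilinear)
  qed
  then show ?thesis by (simp add: complement_def)
qed

lemmas proj_simps [simp] = complement_simps[OF proj_mem]

lemma decomposition:
  "v = proj v + (v \<bullet> X0) *\<^sub>R X0 + (v \<bullet> Y0) *\<^sub>R Y0 + (v \<bullet> Z0) *\<^sub>R Z0 + (v \<bullet> W0) *\<^sub>R W0"
  by (simp add: proj_def)

lemma X_coordinates [simp]: "X x \<bullet> X0 = 1" "X x \<bullet> Y0 = 0" "X x \<bullet> W0 = b x" "proj (X x) = e x"
  by (simp_all add: X_def proj_def inner_simps)

lemma Y_coordinates [simp]: "Y x \<bullet> X0 = 0" "Y x \<bullet> Y0 = 1" "proj (Y x) = f x"
  by (simp_all add: Y_def proj_def inner_simps algebra_simps)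

lemma DX_coordinates [simp]: "DX x h \<bullet> X0 = 0" "DX x h \<bullet> Y0 = 0" "DX x h \<bullet> W0 = b h"
  "proj (DX x h) = e h"
  by (simp_all add: DX_def proj_def inner_simps)

lemma DY_coordinates [simp]: "DY x h \<bullet> X0 = 0" "DY x h \<bullet> Y0 = 0" "proj (DY x h) = f h"
  by (simp_all add: DY_def proj_def inner_simps algebra_simps)

lemma form_XY: "form \<epsilon> (X x) (X x) = 0" "form \<epsilon> (Y x) (Y x) = 0" "form \<epsilon> (X x) (Y x) = 0"
  by (simp_all add: X_def Y_def form_bilinear algebra_simps)

text \<open>Linearizations of the three equations in \<open>form_XY\<close>; they express that the
  differential takes tangent values.\<close>

lemma form_XY_D: "form \<epsilon> (X x) (DX x h) = 0" "form \<epsilon> (Y x) (DY x h) = 0"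
  "form \<epsilon> (X x) (DY x h) + form \<epsilon> (Y x) (DX x h) = 0"
  using form_commute[of \<epsilon> "f x" "e h"]
  by (simp_all add: X_def Y_def DX_def DY_def form_bilinear algebra_simps)

lemma dim_XY: "dim (span {X x, Y x}) = 2"
proof (rule dim_span_pair)
  fix p q assume "p *\<^sub>R X x + q *\<^sub>R Y x = 0"
  then have "(p *\<^sub>R X x + q *\<^sub>R Y x) \<bullet> X0 = 0" "(p *\<^sub>R X x + q *\<^sub>R Y x) \<bullet> Y0 = 0" by simp_all
  then show "p = 0 \<and> q = 0" by (simp add: inner_simps)
qed

lemma mem_\<psi>: "X x \<in> \<psi> x" "Y x \<in> \<psi> x"
  by (auto simp: \<psi>_def span_base)

lemma \<psi>_fano: "\<psi> x \<in> fano \<epsilon>"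
proof -
  have "form \<epsilon> v v = 0" if v_mem: "v \<in> \<psi> x" for v
  proof -
    obtain p q where "v = p *\<^sub>R X x + q *\<^sub>R Y x" using v_mem by (auto simp: \<psi>_def mem_span_pair)
    then show ?thesis
      using form_XY[of x] form_commute[of \<epsilon> "Y x" "X x"] by (simp add: form_bilinear)
  qed
  then show ?thesis using dim_XY[of x] by (auto simp: fano_def quadric_cone_def \<psi>_def)
qed

text \<open>The inner products of \<open>X x\<close> and \<open>Y x\<close> with \<open>X0\<close>
  and \<open>Y0\<close> form the identity matrix, which makes the plane a graph over
  \<open>span {X0, Y0}\<close>.\<close>

lemma \<psi>_coordinates: "v \<in> \<psi> x \<Longrightarrow> v = (v \<bullet> X0) *\<^sub>R X x + (v \<bullet> Y0) *\<^sub>R Y x"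
  by (auto simp: \<psi>_def mem_span_pair inner_simps)

text \<open>The three isotropy equations determine \<open>A \<bullet> Z0\<close>,
  \<open>C \<bullet> Z0\<close> and \<open>C \<bullet> W0\<close> from the projections and
  \<open>A \<bullet> W0\<close>. So every isotropic plane with a frame normalized in this way lies
  in the image of the chart.\<close>

lemma frame_reconstruction:
  assumes "form \<epsilon> A A = 0" "form \<epsilon> C C = 0" "form \<epsilon> A C = 0"
    "A \<bullet> X0 = 1" "A \<bullet> Y0 = 0" "C \<bullet> X0 = 0" "C \<bullet> Y0 = 1"
  defines "x \<equiv> g (proj A, proj C, A \<bullet> W0)"
  shows "X x = A" "Y x = C"
proof -
  have "G x = (proj A, proj C, A \<bullet> W0)" unfolding x_def by (rule G_g) (simp add: proj_mem)
  then have efb: "e x = proj A" "f x = proj C" "b x = A \<bullet> W0" by (simp_all add: e_def f_def b_def)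
  have A: "A = proj A + X0 + (A \<bullet> Z0) *\<^sub>R Z0 + (A \<bullet> W0) *\<^sub>R W0"
    using decomposition[of A] assms by simp
  have C: "C = proj C + Y0 + (C \<bullet> Z0) *\<^sub>R Z0 + (C \<bullet> W0) *\<^sub>R W0"
    using decomposition[of C] assms by simp
  have "form \<epsilon> A A = form \<epsilon> (proj A) (proj A) + 2 * (A \<bullet> Z0)"
    by (subst (1 2) A) (simp add: form_bilinear)
  moreover have "form \<epsilon> C C = form \<epsilon> (proj C) (proj C) + 2 * (C \<bullet> W0)"
    by (subst (1 2) C) (simp add: form_bilinear)
  moreover have "form \<epsilon> A C = form \<epsilon> (proj A) (proj C) + C \<bullet> Z0 + A \<bullet> W0"
    by (subst A, subst C) (simp add: form_bilinear)
  ultimately have "A \<bullet> Z0 = - (form \<epsilon> (proj A) (proj A) / 2)"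
    "C \<bullet> W0 = - (form \<epsilon> (proj C) (proj C) / 2)"
    "C \<bullet> Z0 = - (A \<bullet> W0 + form \<epsilon> (proj A) (proj C))" using assms(1-3) by simp_all
  note coeffs = this
  show "X x = A" by (subst A) (simp add: X_def efb coeffs)
  show "Y x = C" by (subst C) (simp add: Y_def efb coeffs algebra_simps)
qed

lemma frame_parameter: "g (proj (X x), proj (Y x), X x \<bullet> W0) = x"
  using g_G[of x] by (simp add: G_eq)

lemma inj_\<psi>: "inj \<psi>"
proof (rule injI)
  fix x y assume eq: "\<psi> x = \<psi> y"
  then have "X y \<in> \<psi> x" "Y y \<in> \<psi> x" using mem_\<psi>[of y] by auto
  then have "X y = X x" "Y y = Y x" using \<psi>_coordinates by fastforce+
  then show "x = y" using frame_parameter[of x] frame_parameter[of y] by simp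
qed

section \<open>The differential of the graph chart\<close>

lemma X_has_derivative: "(X has_derivative DX x) (at x)"
proof -
  note D = bounded_linear_imp_has_derivative[OF bounded_linear_efb(1)]
    bounded_linear_imp_has_derivative[OF bounded_linear_efb(3)]
  have "(X has_derivative (\<lambda>h. e h - ((form \<epsilon> (e x) (e h) + form \<epsilon> (e h) (e x)) / 2) *\<^sub>R Z0 +
      b h *\<^sub>R W0)) (at x)"
    unfolding X_def[abs_def]
    by (auto intro!: derivative_eq_intros D bounded_bilinear.FDERIV[OF bounded_bilinear_form])
  moreover have "form \<epsilon> (e h) (e x) = form \<epsilon> (e x) (e h)" for h by (rule form_commute)
  ultimately show ?thesis by (simp only: DX_def[abs_def]) simp
qed

lemma Y_has_derivative: "(Y has_derivative DY x) (at x)"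
proof -
  note D = bounded_linear_imp_has_derivative[OF bounded_linear_efb(1)]
    bounded_linear_imp_has_derivative[OF bounded_linear_efb(2)]
    bounded_linear_imp_has_derivative[OF bounded_linear_efb(3)]
  have "(Y has_derivative (\<lambda>h. f h - (b h + (form \<epsilon> (e x) (f h) + form \<epsilon> (e h) (f x))) *\<^sub>R Z0 -
      ((form \<epsilon> (f x) (f h) + form \<epsilon> (f h) (f x)) / 2) *\<^sub>R W0)) (at x)"
    unfolding Y_def[abs_def]
    by (auto intro!: derivative_eq_intros D bounded_bilinear.FDERIV[OF bounded_bilinear_form])
  moreover have "form \<epsilon> (f h) (f x) = form \<epsilon> (f x) (f h)" for h by (rule form_commute)
  ultimately show ?thesis by (simp only: DY_def[abs_def]) (simp add: add.assoc)
qed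

lemmas frechet_XY = frechet_derivative_at[OF X_has_derivative, symmetric]
  frechet_derivative_at[OF Y_has_derivative, symmetric]

lemma smooth_XY: "smooth_on UNIV X" "smooth_on UNIV Y"
proof -
  note lin = bounded_linear_efb[THEN smooth_on_bounded_linear]
  \<comment> \<open>Differences and quotients are rewritten as sums and products, to which the
    smoothness rules apply.\<close>
  have X: "X = (\<lambda>x. X0 + e x + (- 1 / 2 * form \<epsilon> (e x) (e x)) *\<^sub>R Z0 + b x *\<^sub>R W0)"
    by (simp add: X_def fun_eq_iff)
  have Y: "Y = (\<lambda>x. Y0 + f x + (- 1 * (b x + form \<epsilon> (e x) (f x))) *\<^sub>R Z0 +
      (- 1 / 2 * form \<epsilon> (f x) (f x)) *\<^sub>R W0)"
    by (simp add: Y_def fun_eq_iff algebra_simps)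
  show "smooth_on UNIV X" "smooth_on UNIV Y"
    unfolding X Y
    by (intro smooth_on_add smooth_on_const lin open_UNIV smooth_on_bilinear[OF bounded_bilinear_mult]
        smooth_on_bilinear[OF bounded_bilinear_scaleR] smooth_on_bilinear[OF bounded_bilinear_form])+
qed

lemma \<psi>_differential:
  assumes "linear \<phi>" "\<phi> (X x) = DX x h" "\<phi> (Y x) = DY x h"
  shows "plane_differential \<psi> x h = quot_hom (\<psi> x) \<phi>"
  by (rule plane_differential_frame[OF open_UNIV UNIV_I smooth_XY _ assms(1)])
     (simp_all add: \<psi>_def dim_XY[simplified] frechet_XY assms)

text \<open>A vector of \<open>\<psi> x\<close> is determined by its inner products with
  \<open>X0\<close> and \<open>Y0\<close>, and these vanish for \<open>DX\<close> and
  \<open>DY\<close>; so equality modulo the plane is equality. Surjectivity comes from solving the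
  linearized isotropy equations.\<close>

lemma bij_differential: "bij_betw (plane_differential \<psi> x) UNIV (tangent_fano \<epsilon> (\<psi> x))"
proof (rule bij_betwI')
  have extend: "\<exists>\<phi>. linear \<phi> \<and> \<phi> (X x) = DX x h \<and> \<phi> (Y x) = DY x h" for h
    using frame_linear_extension[OF dim_XY] by metis
  have zero: "v = 0" if "v \<in> \<psi> x" "v \<bullet> X0 = 0" "v \<bullet> Y0 = 0" for v
    using \<psi>_coordinates[OF that(1)] that by simp
  fix h k
  show "plane_differential \<psi> x h = plane_differential \<psi> x k \<longleftrightarrow> h = k"
  proof
    assume eq: "plane_differential \<psi> x h = plane_differential \<psi> x k"
    obtain \<phi> \<phi>' where \<phi>: "linear \<phi>" "\<phi> (X x) = DX x h" "\<phi> (Y x) = DY x h"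
      and \<phi>': "linear \<phi>'" "\<phi>' (X x) = DX x k" "\<phi>' (Y x) = DY x k" using extend by metis
    have "quot_hom (\<psi> x) \<phi> = quot_hom (\<psi> x) \<phi>'"
      using eq \<psi>_differential[OF \<phi>] \<psi>_differential[OF \<phi>'] by simp
    then have "DX x h - DX x k \<in> \<psi> x" "DY x h - DY x k \<in> \<psi> x"
      using quot_hom_eq_iff_frame[OF \<phi>(1) \<phi>'(1) \<psi>_def] \<phi> \<phi>' by metis+
    then have "DX x h = DX x k" "DY x h = DY x k"
      using zero[of "DX x h - DX x k"] zero[of "DY x h - DY x k"] by (simp_all add: inner_simps)
    then have "e h = e k" "f h = f k" "b h = b k"
      using DX_coordinates(3,4)[of x] DY_coordinates(3)[of x] by metis+
    then show "h = k" using g_G[of h] g_G[of k] by (simp add: G_eq)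
  qed simp
next
  fix h
  obtain \<phi> where \<phi>: "linear \<phi>" "\<phi> (X x) = DX x h" "\<phi> (Y x) = DY x h"
    using frame_linear_extension[OF dim_XY] .
  have "form \<epsilon> v (\<phi> v) = 0" if v_mem: "v \<in> \<psi> x" for v
  proof -
    obtain p q where v: "v = p *\<^sub>R X x + q *\<^sub>R Y x" using v_mem by (auto simp: \<psi>_def mem_span_pair)
    have "form \<epsilon> v (\<phi> v) = p * (p * form \<epsilon> (X x) (DX x h)) + q * (q * form \<epsilon> (Y x) (DY x h)) +
        p * q * (form \<epsilon> (X x) (DY x h) + form \<epsilon> (Y x) (DX x h))"
      using \<phi> by (simp add: v linear_add linear_cmul form_bilinear algebra_simps)
    then show ?thesis by (simp only: form_XY_D)
  qed
  then show "plane_differential \<psi> x h \<in> tangent_fano \<epsilon> (\<psi> x)"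
    using quot_hom_in_tangent_fano_iff[OF \<psi>_fano \<phi>(1)] \<psi>_differential[OF \<phi>] by simp
next
  fix \<Phi> assume \<Phi>: "\<Phi> \<in> tangent_fano \<epsilon> (\<psi> x)"
  then obtain \<phi> where \<phi>: "linear \<phi>" "\<Phi> = quot_hom (\<psi> x) \<phi>"
    by (auto simp: tangent_fano_def Hom_quot_def)
  have tan: "form \<epsilon> v (\<phi> v) = 0" if "v \<in> \<psi> x" for v
    using quot_hom_in_tangent_fano_iff[OF \<psi>_fano \<phi>(1)] \<Phi> \<phi>(2) that by blast
  have sub: "subspace (\<psi> x)" by (simp add: \<psi>_def)
  \<comment> \<open>\<open>red\<close> subtracts the vector of \<open>\<psi> x\<close> with the same
    inner products with \<open>X0\<close> and \<open>Y0\<close>; this gives the representative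
    modulo the plane that is comparable with \<open>DX\<close> and \<open>DY\<close>.\<close>
  define red where "red v = v - (v \<bullet> X0) *\<^sub>R X x - (v \<bullet> Y0) *\<^sub>R Y x" for v
  have red_inner: "red v \<bullet> X0 = 0" "red v \<bullet> Y0 = 0" for v by (simp_all add: red_def inner_simps)
  have red_mem: "v - red v \<in> \<psi> x" for v by (auto simp: red_def \<psi>_def mem_span_pair)
  have red_form: "form \<epsilon> u (red v) = form \<epsilon> u v" if "u \<in> \<psi> x" for u v
    using fano_isotropic[OF \<psi>_fano that red_mem] by (simp add: form_bilinear)
  define \<xi> where "\<xi> = red (\<phi> (X x))"
  define \<eta> where "\<eta> = red (\<phi> (Y x))"
  have "form \<epsilon> (X x + Y x) (\<phi> (X x + Y x)) = 0" using mem_\<psi> sub by (intro tan subspace_add)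
  then have "form \<epsilon> (X x) (\<phi> (Y x)) + form \<epsilon> (Y x) (\<phi> (X x)) = 0"
    using tan[OF mem_\<psi>(1)] tan[OF mem_\<psi>(2)] \<phi>(1) by (simp add: linear_add form_bilinear)
  then have eqs: "form \<epsilon> (X x) \<xi> = 0" "form \<epsilon> (Y x) \<eta> = 0" "form \<epsilon> (X x) \<eta> + form \<epsilon> (Y x) \<xi> = 0"
    using tan[OF mem_\<psi>(1)] tan[OF mem_\<psi>(2)] by (simp_all add: \<xi>_def \<eta>_def red_form mem_\<psi>)
  \<comment> \<open>The free coordinates of \<open>\<xi>\<close> and \<open>\<eta>\<close> determine
    \<open>h\<close>; \<open>eqs\<close> then forces the remaining ones to be those of
    \<open>DX x h\<close> and \<open>DY x h\<close>.\<close>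
  define h where "h = g (proj \<xi>, proj \<eta>, \<xi> \<bullet> W0)"
  have "G h = (proj \<xi>, proj \<eta>, \<xi> \<bullet> W0)" unfolding h_def by (rule G_g) (simp add: proj_mem)
  then have efb: "e h = proj \<xi>" "f h = proj \<eta>" "b h = \<xi> \<bullet> W0" by (simp_all add: e_def f_def b_def)
  have \<xi>: "\<xi> = proj \<xi> + (\<xi> \<bullet> Z0) *\<^sub>R Z0 + (\<xi> \<bullet> W0) *\<^sub>R W0"
    using decomposition[of \<xi>] by (simp add: \<xi>_def red_inner)
  have \<eta>: "\<eta> = proj \<eta> + (\<eta> \<bullet> Z0) *\<^sub>R Z0 + (\<eta> \<bullet> W0) *\<^sub>R W0"
    using decomposition[of \<eta>] by (simp add: \<eta>_def red_inner)
  have "form \<epsilon> (X x) \<xi> = form \<epsilon> (e x) (proj \<xi>) + \<xi> \<bullet> Z0"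
    by (subst \<xi>) (simp add: X_def form_bilinear)
  moreover have "form \<epsilon> (Y x) \<xi> = form \<epsilon> (f x) (proj \<xi>) + \<xi> \<bullet> W0"
    by (subst \<xi>) (simp add: Y_def form_bilinear)
  moreover have "form \<epsilon> (X x) \<eta> = form \<epsilon> (e x) (proj \<eta>) + \<eta> \<bullet> Z0"
    by (subst \<eta>) (simp add: X_def form_bilinear)
  moreover have "form \<epsilon> (Y x) \<eta> = form \<epsilon> (f x) (proj \<eta>) + \<eta> \<bullet> W0"
    by (subst \<eta>) (simp add: Y_def form_bilinear)
  ultimately have coeffs: "\<xi> \<bullet> Z0 = - form \<epsilon> (e x) (proj \<xi>)" "\<eta> \<bullet> W0 = - form \<epsilon> (f x) (proj \<eta>)"
    "\<eta> \<bullet> Z0 = - (\<xi> \<bullet> W0 + form \<epsilon> (e x) (proj \<eta>) + form \<epsilon> (proj \<xi>) (f x))"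
    using eqs form_commute[of \<epsilon> "f x" "proj \<xi>"] by linarith+
  have "DX x h = \<xi>" by (subst \<xi>) (simp add: DX_def efb coeffs)
  moreover have "DY x h = \<eta>" by (subst \<eta>) (simp add: DY_def efb coeffs algebra_simps)
  ultimately have D: "\<phi> (X x) - DX x h \<in> \<psi> x" "\<phi> (Y x) - DY x h \<in> \<psi> x"
    using red_mem by (simp_all add: \<xi>_def \<eta>_def)
  obtain \<phi>' where \<phi>': "linear \<phi>'" "\<phi>' (X x) = DX x h" "\<phi>' (Y x) = DY x h"
    using frame_linear_extension[OF dim_XY] .
  have "\<Phi> = plane_differential \<psi> x h"
    using quot_hom_eq_iff_frame[OF \<phi>(1) \<phi>'(1) \<psi>_def] D \<phi>(2) \<phi>' \<psi>_differential[OF \<phi>'] by simp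
  then show "\<exists>h\<in>UNIV. \<Phi> = plane_differential \<psi> x h" by blast
qed

text \<open>A frame (A, C) with nonzero determinant against (X0, Y0) is normalized linearly to a frame
  (N, M) of the same plane that is dual to (X0, Y0), and the chart coordinates are read off from it.\<close>

lemma open_map_\<psi>: "open_map (top_of_set UNIV) (fano_topology \<epsilon>) \<psi>"
  unfolding open_map_def
proof (intro allI impI)
  fix S :: "(real ^ ('n + 'n + 1)) set"
  assume "openin (top_of_set UNIV) S"
  then have S: "open S" by simp
  define D where "D z = (fst z \<bullet> X0) * (snd z \<bullet> Y0) - (fst z \<bullet> Y0) * (snd z \<bullet> X0)" for z :: "'n vec4 \<times> 'n vec4"
  define N where "N z = (1 / D z) *\<^sub>R ((snd z \<bullet> Y0) *\<^sub>R fst z - (fst z \<bullet> Y0) *\<^sub>R snd z)" for z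
  define M where "M z = (1 / D z) *\<^sub>R ((fst z \<bullet> X0) *\<^sub>R snd z - (snd z \<bullet> X0) *\<^sub>R fst z)" for z
  define c where "c z = g (proj (N z), proj (M z), N z \<bullet> W0)" for z
  have normal: "N z \<bullet> X0 = 1" "N z \<bullet> Y0 = 0" "M z \<bullet> X0 = 0" "M z \<bullet> Y0 = 1" if "D z \<noteq> 0" for z
    using that by (simp_all add: N_def M_def inner_simps divide_simps) (simp_all add: D_def)
  have NM_mem: "N z \<in> span {fst z, snd z}" "M z \<in> span {fst z, snd z}" for z
    unfolding N_def M_def by (intro span_scale span_diff span_base; simp)+
  have "open {z. D z \<noteq> 0}"
    unfolding D_def by (intro open_Collect_neq continuous_intros)
  moreover have "continuous_on {z. D z \<noteq> 0} c"
  proof -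
    have D: "continuous_on {z. D z \<noteq> 0} D" unfolding D_def by (intro continuous_intros)
    have "continuous_on {z. D z \<noteq> 0} N" "continuous_on {z. D z \<noteq> 0} M"
      unfolding N_def M_def by (intro continuous_intros D; simp)+
    then have NM: "continuous_on {z. D z \<noteq> 0} (\<lambda>z. (proj (N z), proj (M z), N z \<bullet> W0))"
      unfolding proj_def by (intro continuous_intros)
    have "continuous_on UNIV g"
      using linear_g by (simp add: linear_continuous_on linear_conv_bounded_linear)
    then show ?thesis unfolding c_def by (rule continuous_on_compose2[OF _ NM]) simp
  qed
  ultimately have "open ({z. D z \<noteq> 0} \<inter> c -` S)" using S by (metis continuous_open_preimage)
  moreover have "{(A, C) \<in> fano_frames \<epsilon>. span {A, C} \<in> \<psi> ` S} = fano_frames \<epsilon> \<inter> ({z. D z \<noteq> 0} \<inter> c -` S)"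
  proof (intro set_eqI)
    fix z :: "'n vec4 \<times> 'n vec4"
    obtain A C where z: "z = (A, C)" by fastforce
    have "span {A, C} \<in> \<psi> ` S \<longleftrightarrow> D z \<noteq> 0 \<and> c z \<in> S" if F: "span {A, C} \<in> fano \<epsilon>"
    proof
      assume "span {A, C} \<in> \<psi> ` S"
      then obtain x where x: "x \<in> S" "span {A, C} = \<psi> x" by auto
      obtain p q r s where X: "X x = p *\<^sub>R A + q *\<^sub>R C" and Y: "Y x = r *\<^sub>R A + s *\<^sub>R C"
        using mem_\<psi>[of x] unfolding x(2)[symmetric] mem_span_pair by blast
      have "p * (A \<bullet> X0) + q * (C \<bullet> X0) = 1" "p * (A \<bullet> Y0) + q * (C \<bullet> Y0) = 0"
        "r * (A \<bullet> X0) + s * (C \<bullet> X0) = 0" "r * (A \<bullet> Y0) + s * (C \<bullet> Y0) = 1"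
        using X_coordinates(1,2)[of x] Y_coordinates(1,2)[of x] by (simp_all add: X Y inner_simps)
      \<comment> \<open>Determinants multiply: the frame of the chart has the identity matrix of
        inner products with \<open>X0\<close> and \<open>Y0\<close>.\<close>
      then have "(p * s - q * r) * D z = 1" unfolding D_def z fst_conv snd_conv by algebra
      then have D: "D z \<noteq> 0" by auto
      have "N z \<in> \<psi> x" "M z \<in> \<psi> x" using NM_mem[of z] by (simp_all add: z x(2))
      then have "N z = X x" "M z = Y x" using \<psi>_coordinates normal[OF D] by fastforce+
      then have "c z = x" using frame_parameter[of x] by (simp add: c_def)
      then show "D z \<noteq> 0 \<and> c z \<in> S" using D x(1) by simp
    next
      assume D: "D z \<noteq> 0 \<and> c z \<in> S"
      have mem: "N z \<in> span {A, C}" "M z \<in> span {A, C}" using NM_mem[of z] by (simp_all add: z)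
      have XY: "X (c z) = N z" "Y (c z) = M z"
        unfolding c_def
        by (rule frame_reconstruction; use D normal[of z] fano_isotropic[OF F] mem in blast)+
      have "dim (span {A, C}) = 2" using F by (simp add: fano_def)
      then have "\<psi> (c z) = span {A, C}"
        unfolding \<psi>_def using dim_XY[of "c z"] mem by (intro span_pair_eq) (simp_all only: XY)
      then show "span {A, C} \<in> \<psi> ` S" using D by (metis imageI)
    qed
    then show "z \<in> {(A, C) \<in> fano_frames \<epsilon>. span {A, C} \<in> \<psi> ` S} \<longleftrightarrow>
        z \<in> fano_frames \<epsilon> \<inter> ({z. D z \<noteq> 0} \<inter> c -` S)"
      unfolding z fano_frames_def by auto
  qed
  ultimately show "openin (fano_topology \<epsilon>) (\<psi> ` S)"
    unfolding openin_fano_topology using \<psi>_fano by (auto intro: openin_open_Int)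
qed

section \<open>Charts around every line and the contact structure\<close>

lemma fano_chart_\<psi>: "fano_chart \<epsilon> UNIV \<psi>"
  unfolding fano_chart_def
proof (intro conjI ballI)
  show "smooth_plane_map UNIV \<psi>"
    unfolding smooth_plane_map_def using smooth_XY dim_XY \<psi>_def open_UNIV by fastforce
qed (use \<psi>_fano inj_\<psi> open_map_\<psi> bij_differential in auto)

lemma \<psi>_zero: "\<psi> 0 = span {X0, Y0}"
proof -
  have "e 0 = 0" "f 0 = 0" "b 0 = 0" using linear_0[OF linear_G] by (simp_all add: e_def f_def b_def)
  then show ?thesis by (simp add: \<psi>_def X_def Y_def form_bilinear)
qed

end

text \<open>The graph chart over \<open>L\<close> itself, whose centre 0 is sent to
  \<open>L\<close>. By \<open>dim_complement\<close> the parameter space has dimension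
  \<open>n + n + 1\<close>, so \<open>isometries_subspaces\<close> supplies the linear
  identification.\<close>

lemma (in unit_signs) chart_exists:
  assumes "L \<in> fano \<epsilon>"
  shows "\<exists>U \<psi>. fano_chart \<epsilon> U \<psi> \<and> L \<in> \<psi> ` U"
proof -
  obtain X0 Y0 where XY: "L = span {X0, Y0}" "X0 \<bullet> X0 = 1" "Y0 \<bullet> Y0 = 1" "X0 \<bullet> Y0 = 0"
    using fano_orthonormal_frame[OF assms] .
  let ?E = "complement \<epsilon> L"
  have sub: "subspace (?E \<times> (UNIV :: real set))" "subspace (?E \<times> ?E \<times> (UNIV :: real set))"
    by (intro subspace_Times subspace_complement subspace_UNIV)+
  have "dim (?E \<times> ?E \<times> (UNIV :: real set)) = DIM(real ^ ('n + 'n + 1))"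
    using sub by (simp add: dim_Times subspace_complement dim_complement[OF assms])
  then have dim: "dim (UNIV :: (real ^ ('n + 'n + 1)) set) = dim (?E \<times> ?E \<times> (UNIV :: real set))"
    by (simp only: dim_UNIV)
  obtain G :: "real ^ ('n + 'n + 1) \<Rightarrow> 'n vec4 \<times> 'n vec4 \<times> real" and g where
    G: "linear G" "linear g" "G ` UNIV = ?E \<times> ?E \<times> UNIV" "\<And>x. x \<in> UNIV \<Longrightarrow> g (G x) = x"
      "\<And>y. y \<in> ?E \<times> ?E \<times> UNIV \<Longrightarrow> G (g y) = y"
    by (rule isometries_subspaces[OF subspace_UNIV sub(2) dim]) blast
  have mem: "G x \<in> ?E \<times> ?E \<times> UNIV" for x using G(3) by blast
  have g_G: "g (G x) = x" for x by (rule G(4)) simp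
  interpret adapted_frame \<epsilon> X0 Y0 G g
    by (intro adapted_frame.intro adapted_frame_axioms.intro unit_signs_axioms;
        fact assms[unfolded XY(1)] XY G(1,2) mem[unfolded XY(1)] g_G G(5)[unfolded XY(1)])
  show ?thesis using fano_chart_\<psi> \<psi>_zero XY(1) by (metis UNIV_I image_eqI)
qed

theorem lemma5:
  fixes \<epsilon> :: "'n::finite \<Rightarrow> real"
  assumes "\<And>i. \<epsilon> i = 1 \<or> \<epsilon> i = - 1"
  shows "contact_structure_on_fano \<epsilon> (tau \<epsilon>)"
proof -
  interpret unit_signs \<epsilon> using assms by unfold_locales
  show ?thesis
    unfolding contact_structure_on_fano_def
    using chart_exists chart_contact_distribution by (auto simp: tau_def)
qed

end
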